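(* Let $\mathbf{p}=(p,s)$ with $p\in(0,1]$, $s\in\mathbb{R}$, let $\mathbf{p}':=(\infty,-s;n(\frac1p-1))$, and let $c$ be a Whitney parameter. Then for all $f,g\in L^0(\mathbb{R}^{1+n}_+)$, \[ \iint_{\mathbb{R}^{1+n}_+}|(f(t,x),g(t,x))|\,dx\,\frac{dt}{t}\lesssim\|f\|_{Z^{\mathbf{p}}_c}\|g\|_{Z^{\mathbf{p}'}_c}, \] and the pairing $\langle f,g\rangle=\iint(f,g)\,dx\,\frac{dt}{t}$ identifies the Banach space dual of $Z^{\mathbf{p}}_c$ with $Z^{\mathbf{p}'}_c$.
   Context: Fix $n,N\ge1$; functions on $\mathbb{R}^{1+n}_+:=(0,\infty)\times\mathbb{R}^n$ are $\mathbb{C}^N$-valued, $(\cdot,\cdot)$ is the inner product on $\mathbb{C}^N$. A Whitney parameter is $c=(c_0,c_1)\in(0,\infty)\times(3/2,\infty)$; $\Omega_c(t,x):=(c_1^{-1}t,c_1t)\times B(x,c_0t)$; $\mathcal{W}_cf(t,x):=\big(|\Omega_c(t,x)|^{-1}\iint_{\Omega_c(t,x)}|f|^2\big)^{1/2}$; $\kappa^af(t,x)=t^af(t,x)$. For a finite exponent $(q,a)$, $\|f\|_{Z^{(q,a)}_c}:=\|\mathcal{W}_c(\kappa^{-a}f)\|_{L^q(\mathbb{R}^{1+n}_+,dx\,dt/t)}$; for an infinite exponent $(\infty,a;\beta)$ ($\beta\ge0$), $\|f\|_{Z^{(\infty,a;\beta)}_c}:=\|\mathcal{W}_c(\kappa^{-(a+\beta)}f)\|_{L^\infty}$.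 $Z^{\mathbf{q}}_c$ is the space of $f$ with finite quasinorm. *)

theory Defs
  imports "HOL-Analysis.Analysis"
begin

text \<open>Points of the upper half-space are pairs (t,x) with x in real^'n (n = CARD('n));
  values lie in complex^'m (N = CARD('m)).\<close>

definition upper_half :: "(real \<times> (real^'n)) set" where
  "upper_half = {z. fst z > 0}"

text \<open>Real powers of extended nonnegative reals (exponent r > 0).\<close>
definition enn_rpow :: "ennreal \<Rightarrow> real \<Rightarrow> ennreal" where
  "enn_rpow x r = (if x = \<infinity> then \<infinity> else ennreal (enn2real x powr r))"

definition cinner :: "complex^'m \<Rightarrow> complex^'m \<Rightarrow> complex" where
  "cinner u v = (\<Sum>i\<in>UNIV. u $ i * cnj (v $ i))"

definition whitney_param :: "real \<times> real \<Rightarrow> bool" where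
  "whitney_param c \<longleftrightarrow> fst c > 0 \<and> snd c > 3/2"

definition whitney_region :: "real \<times> real \<Rightarrow> real \<times> (real^'n) \<Rightarrow> (real \<times> (real^'n)) set" where
  "whitney_region c z = {w. fst z / snd c < fst w \<and> fst w < snd c * fst z
                          \<and> dist (snd w) (snd z) < fst c * fst z}"

definition whitney_avg :: "real \<times> real \<Rightarrow> (real \<times> (real^'n) \<Rightarrow> complex^'m) \<Rightarrow> real \<times> (real^'n) \<Rightarrow> ennreal" where
  "whitney_avg c f z = enn_rpow
     ((\<integral>\<^sup>+ w \<in> whitney_region c z. ennreal ((norm (f w))\<^sup>2) \<partial>lebesgue)
        / emeasure lebesgue (whitney_region c z)) (1/2)"

definition kappa :: "real \<Rightarrow> (real \<times> (real^'n) \<Rightarrow> complex^'m) \<Rightarrow> real \<times> (real^'n) \<Rightarrow> complex^'m" where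
  "kappa a f z = (fst z powr a) *\<^sub>R f z"

definition half_measure :: "(real \<times> (real^'n)) measure" where
  "half_measure = density lebesgue (\<lambda>z. indicator upper_half z * ennreal (1 / fst z))"

definition Z_fin :: "real \<Rightarrow> real \<Rightarrow> real \<times> real \<Rightarrow> (real \<times> (real^'n) \<Rightarrow> complex^'m) \<Rightarrow> ennreal" where
  "Z_fin q a c f = enn_rpow (\<integral>\<^sup>+ z. enn_rpow (whitney_avg c (kappa (-a) f) z) q \<partial>half_measure) (1/q)"

definition Z_inf :: "real \<Rightarrow> real \<Rightarrow> real \<times> real \<Rightarrow> (real \<times> (real^'n) \<Rightarrow> complex^'m) \<Rightarrow> ennreal" where
  "Z_inf a \<beta> c f = Inf {C. AE z in half_measure. whitney_avg c (kappa (-(a+\<beta>)) f) z \<le> C}"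

definition pairing :: "(real \<times> (real^'n) \<Rightarrow> complex^'m) \<Rightarrow> (real \<times> (real^'n) \<Rightarrow> complex^'m) \<Rightarrow> complex" where
  "pairing f g = (\<integral> z. cinner (f z) (g z) \<partial>half_measure)"

end

theory Submission
  imports Defs
begin

text \<open>
  Partition the half-space into countably many Whitney cells, so small that each cell lies in the Whitney
  region of each of its points. With \<open>d\<^sub>i\<close> the suitably scaled \<open>L\<^sup>2\<close> mass of a function on the \<open>i\<close>-th cell
  of height \<open>T\<^sub>i\<close>, the squared Whitney average is bounded below by \<open>d\<^sub>i\<close> on that cell and above by the sum of the
  \<open>d\<^sub>i\<close> over boundedly many neighbouring cells. Hence both quasinorms are equivalent to weighted sequence
  norms: \<open>\<ell>\<^sup>p\<close> of \<open>\<surd>d\<^sub>i\<close> with weights \<open>T\<^sub>i\<^sup>n\<close> on one side, \<open>\<ell>\<^sup>\<infinity>\<close> of \<open>\<surd>d\<^sub>i\<close> on the other.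
  The pairing estimate is the Cauchy-Schwarz inequality on each cell together with \<open>\<ell>\<^sup>p \<subseteq> \<ell>\<^sup>1\<close> for \<open>p \<le> 1\<close>.
  Conversely, a bounded functional restricts to a bounded functional on \<open>L\<^sup>2\<close> of each cell; the Riesz
  representatives glue to a function whose masses are controlled by testing the functional against
  the representative itself, and finite unions of cells exhaust every element of the space because \<open>p\<close> is finite.
\<close>

section \<open>Real powers of extended nonnegative reals\<close>

text \<open>The ratio \<open>3/2\<close> between the heights in a cell is dictated by the bound
  \<open>snd c > 3/2\<close>: it makes a single grid shape work for every Whitney parameter. The
  extra weight n(1/p - 1) comes from scaling: at height T the three powers of T, namely T^(n/p) from
  the measure of a cell in the \<open>p\<close>-quasinorm and the normalisations of the two cell
  masses, must multiply to T^(-1), the density of dt/t. The same balance makes tests on single cells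
  uniform in the cell. Such tests suffice because the dual of a weighted \<ell>^p with p \<le> 1 is
  a weighted \<ell>^\<infinity>, so no combination of cells can detect more than the worst single
  cell. Whitney averages are never proved measurable: they are compared pointwise, almost
  everywhere, with countable sums of cell indicators, and \<open>nn_integral\<close> is monotone for
  arbitrary integrands. For p < 1 only a quasinorm is available, so limits are taken in its p-th
  power, which the discrete sum controls directly.\<close>

lemma enn_rpow_ennreal: "0 \<le> x \<Longrightarrow> enn_rpow (ennreal x) r = ennreal (x powr r)"
  by (simp add: enn_rpow_def)

lemma enn_rpow_top [simp]: "enn_rpow \<infinity> r = \<infinity>" "enn_rpow top r = top"
  by (simp_all add: enn_rpow_def)

lemma enn_rpow_0 [simp]: "enn_rpow 0 r = 0"
  by (simp add: enn_rpow_def)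

lemma enn_rpow_1 [simp]: "enn_rpow x 1 = x"
  by (cases x) (auto simp: enn_rpow_def)

lemma enn_rpow_lt_top_iff [simp]: "enn_rpow x r < top \<longleftrightarrow> x < top"
  by (cases x) (auto simp: enn_rpow_def)

lemma enn_rpow_rpow: "enn_rpow (enn_rpow x a) b = enn_rpow x (a * b)"
  by (cases x) (auto simp: enn_rpow_def powr_powr)

lemma enn_rpow_mono:
  assumes "0 \<le> r" "x \<le> y"
  shows "enn_rpow x r \<le> enn_rpow y r"
proof (cases y)
  case (real b)
  then obtain a where "x = ennreal a" "0 \<le> a" using assms by (cases x) (auto simp: top_unique)
  then show ?thesis using real assms by (auto simp: enn_rpow_ennreal intro!: ennreal_leI powr_mono2)
qed auto

text \<open>A power and its inverse power are adjoint, so exponents can be moved across an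
  inequality. Infinite sums are later reached from partial sums in this way, without continuity of
  \<open>enn_rpow\<close>.\<close>

lemma enn_rpow_le_iff:
  assumes "0 < r"
  shows "enn_rpow x r \<le> y \<longleftrightarrow> x \<le> enn_rpow y (1/r)"
proof
  assume "enn_rpow x r \<le> y"
  from enn_rpow_mono[OF _ this, of "1/r"] show "x \<le> enn_rpow y (1/r)"
    using assms by (simp add: enn_rpow_rpow)
next
  assume "x \<le> enn_rpow y (1/r)"
  from enn_rpow_mono[OF _ this, of r] show "enn_rpow x r \<le> y"
    using assms by (simp add: enn_rpow_rpow)
qed

lemma enn_rpow_mult:
  assumes "0 < r"
  shows "enn_rpow (x * y) r = enn_rpow x r * enn_rpow y r"
proof (cases "x = 0 \<or> y = 0")
  case True
  then show ?thesis by auto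
next
  case False
  show ?thesis
  proof (cases x)
    case x: (real a)
    show ?thesis
    proof (cases y)
      case (real b)
      then show ?thesis using x
        by (simp add: enn_rpow_ennreal powr_mult ennreal_mult flip: ennreal_mult)
    next
      case top
      then show ?thesis using x False
        by (auto simp: enn_rpow_ennreal ennreal_mult_top)
    qed
  next
    case top
    then show ?thesis using False
      by (cases y) (auto simp: enn_rpow_ennreal ennreal_top_mult)
  qed
qed

text \<open>After division by the sum both terms lie in [0,1], where a number is at most its
  \<open>r\<close>-th power; the two quotients add up to 1.\<close>

lemma powr_add_le_add_powr:
  fixes x y r :: real
  assumes "0 \<le> x" "0 \<le> y" "0 < r" "r \<le> 1"
  shows "(x + y) powr r \<le> x powr r + y powr r"
proof (cases "x + y = 0")
  case False
  define S where "S = x + y"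
  have S: "S > 0" using False assms unfolding S_def by simp
  have *: "a / S \<le> (a / S) powr r" if "0 \<le> a" "a \<le> S" for a
    using powr_mono'[of r 1 "a / S"] that S assms by auto
  have "1 = x / S + y / S" using S by (simp add: S_def flip: add_divide_distrib)
  also have "\<dots> \<le> (x / S) powr r + (y / S) powr r"
    using assms by (intro add_mono *) (auto simp: S_def)
  also have "\<dots> = (x powr r + y powr r) / S powr r"
    using assms S by (simp add: powr_divide add_divide_distrib)
  finally show ?thesis using S by (simp add: S_def field_simps)
qed (use assms in simp)

lemma enn_rpow_add_le:
  assumes "0 < r" "r \<le> 1"
  shows "enn_rpow (x + y) r \<le> enn_rpow x r + enn_rpow y r"
proof (cases x)
  case x: (real a)
  show ?thesis
  proof (cases y)
    case (real b)
    then show ?thesis using x assms powr_add_le_add_powr[of a b r]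
      by (simp add: enn_rpow_ennreal flip: ennreal_plus)
  qed (use x in auto)
qed auto

lemma enn_rpow_sum_le:
  assumes "0 < r" "r \<le> 1" "finite A"
  shows "enn_rpow (\<Sum>i\<in>A. x i) r \<le> (\<Sum>i\<in>A. enn_rpow (x i) r)"
  using assms(3)
proof induction
  case (insert a A)
  then show ?case
    using order_trans[OF enn_rpow_add_le[OF assms(1,2), of "x a" "sum x A"]] by (simp add: add_left_mono)
qed auto

lemma enn_rpow_suminf_le:
  assumes "0 < r" "r \<le> 1"
  shows "enn_rpow (\<Sum>i. x i) r \<le> (\<Sum>i. enn_rpow (x i) r)"
proof -
  let ?S = "\<Sum>i. enn_rpow (x i) r"
  have "(\<Sum>i<n. x i) \<le> enn_rpow ?S (1/r)" for n
  proof -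
    have "enn_rpow (\<Sum>i<n. x i) r \<le> (\<Sum>i<n. enn_rpow (x i) r)"
      using assms by (intro enn_rpow_sum_le) auto
    also have "\<dots> \<le> ?S" by (intro sum_le_suminf) auto
    finally show ?thesis using assms by (simp add: enn_rpow_le_iff)
  qed
  then have "(\<Sum>i. x i) \<le> enn_rpow ?S (1/r)"
    by (intro suminf_le_const) auto
  then show ?thesis using assms by (simp add: enn_rpow_le_iff)
qed

text \<open>The inclusion of \<ell>^r in \<ell>^1, with \<open>x i\<close> in the role of the
  \<open>r\<close>-th power of the i-th term.\<close>

lemma suminf_enn_rpow_le:
  assumes "0 < r" "r \<le> 1"
  shows "(\<Sum>i. enn_rpow (x i) (1/r)) \<le> enn_rpow (\<Sum>i. x i) (1/r)"
  using enn_rpow_suminf_le[OF assms, of "\<lambda>i. enn_rpow (x i) (1/r)"] assms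
  by (simp add: enn_rpow_le_iff enn_rpow_rpow)

text \<open>An infimum in \<open>ennreal\<close> is reached along a sequence of members, so only
  countably many null sets have to be united.\<close>

lemma AE_le_essential_Inf:
  fixes h :: "'a \<Rightarrow> ennreal"
  shows "AE z in M. h z \<le> Inf {C. AE z in M. h z \<le> C}"
proof -
  let ?S = "{C. AE z in M. h z \<le> C}"
  have "top \<in> ?S" by simp
  then have "?S \<noteq> {}" by blast
  from ennreal_Inf_countable_INF[OF this] obtain f :: "nat \<Rightarrow> ennreal"
    where f: "range f \<subseteq> ?S" "Inf ?S = (INF i. f i)" by blast
  have "AE z in M. \<forall>i. h z \<le> f i" using f(1) by (subst AE_all_countable) auto
  then show ?thesis unfolding f(2) by (auto intro: INF_greatest)
qed

text \<open>Lets a power of the height be frozen at the scale of a cell. The absolute value in the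
  exponent makes one constant serve for both signs of \<open>a\<close>.\<close>

lemma powr_comparable:
  fixes T t l a :: real
  assumes "0 < T" "0 < t" "t \<le> l * T" "T \<le> l * t"
  shows "t powr a \<le> l powr \<bar>a\<bar> * T powr a"
proof -
  have l: "l > 0" using assms zero_less_mult_pos2[of l T] by linarith
  show ?thesis
  proof (cases "a \<ge> 0")
    case True
    then have "t powr a \<le> (l * T) powr a" using assms by (intro powr_mono2) auto
    then show ?thesis using True l assms by (simp add: powr_mult)
  next
    case False
    have "T / l \<le> t" using assms l by (simp add: field_simps)
    then have "t powr a \<le> (T / l) powr a" using False assms l by (intro powr_mono2') auto
    then show ?thesis using False l assms by (simp add: powr_divide powr_minus field_simps)
  qed
qed

section \<open>Riesz representation in vector-valued \<open>L\<^sup>2\<close>\<close>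

definition sq_integrable :: "'a measure \<Rightarrow> ('a \<Rightarrow> 'b::euclidean_space) \<Rightarrow> bool" where
  "sq_integrable M f \<longleftrightarrow> f \<in> borel_measurable M \<and> integrable M (\<lambda>x. (norm (f x))\<^sup>2)"

lemma sq_integrable_measurable: "sq_integrable M f \<Longrightarrow> f \<in> borel_measurable M"
  by (simp add: sq_integrable_def)

lemma sq_integrable_scale:
  "sq_integrable M f \<Longrightarrow> sq_integrable M (\<lambda>x. r *\<^sub>R f x)"
  by (auto simp: sq_integrable_def power_mult_distrib)

lemma sq_integrable_add:
  assumes "sq_integrable M f" "sq_integrable M g"
  shows "sq_integrable M (\<lambda>x. f x + g x)"
proof -
  note [measurable] = assms[THEN sq_integrable_measurable]
  have "integrable M (\<lambda>x. (norm (f x + g x))\<^sup>2)"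
  proof (rule Bochner_Integration.integrable_bound)
    show "integrable M (\<lambda>x. 2 * (norm (f x))\<^sup>2 + 2 * (norm (g x))\<^sup>2)"
      using assms by (auto simp: sq_integrable_def)
    have "(norm (f x + g x))\<^sup>2 \<le> 2 * (norm (f x))\<^sup>2 + 2 * (norm (g x))\<^sup>2" for x
    proof -
      have "(norm (f x + g x))\<^sup>2 \<le> (norm (f x) + norm (g x))\<^sup>2"
        by (intro power_mono norm_triangle_ineq) auto
      also have "\<dots> \<le> 2 * (norm (f x))\<^sup>2 + 2 * (norm (g x))\<^sup>2"
        using sum_squares_bound[of "norm (f x)" "norm (g x)"] by (simp add: power2_sum)
      finally show ?thesis .
    qed
    then show "AE x in M. norm ((norm (f x + g x))\<^sup>2) \<le> norm (2 * (norm (f x))\<^sup>2 + 2 * (norm (g x))\<^sup>2)"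
      by simp
  qed simp
  then show ?thesis by (simp add: sq_integrable_def)
qed

lemma sq_integrable_diff:
  assumes "sq_integrable M f" "sq_integrable M g"
  shows "sq_integrable M (\<lambda>x. f x - g x)"
  using sq_integrable_add[OF assms(1) sq_integrable_scale[OF assms(2), of "-1"]] by simp

text \<open>The free weight \<open>e\<close> is what the Riesz argument needs: a squared error of
  order e^2, divided by \<open>e\<close>, still leaves a bound of order \<open>e\<close>.\<close>

lemma two_abs_inner_le:
  fixes a b :: "'b::real_inner"
  assumes "0 < e"
  shows "2 * \<bar>a \<bullet> b\<bar> \<le> (norm a)\<^sup>2 / e + e * (norm b)\<^sup>2"
proof -
  have "0 \<le> (norm a / sqrt e - sqrt e * norm b)\<^sup>2" by simp
  also have "\<dots> = (norm a)\<^sup>2 / e + e * (norm b)\<^sup>2 - 2 * (norm a * norm b)"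
    using assms by (simp add: power2_diff power_divide power_mult_distrib)
  finally show ?thesis using Cauchy_Schwarz_ineq2[of a b] by linarith
qed

lemma sq_integrable_inner:
  assumes "sq_integrable M f" "sq_integrable M g"
  shows "integrable M (\<lambda>x. f x \<bullet> g x)"
proof (rule Bochner_Integration.integrable_bound)
  note [measurable] = assms[THEN sq_integrable_measurable]
  show "integrable M (\<lambda>x. (norm (f x))\<^sup>2 + (norm (g x))\<^sup>2)"
    using assms by (auto simp: sq_integrable_def)
  show "AE x in M. norm (f x \<bullet> g x) \<le> norm ((norm (f x))\<^sup>2 + (norm (g x))\<^sup>2)"
  proof (rule AE_I2)
    fix x
    have "2 * \<bar>f x \<bullet> g x\<bar> \<le> (norm (f x))\<^sup>2 + (norm (g x))\<^sup>2"
      using two_abs_inner_le[of 1 "f x" "g x"] by simp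
    then have "\<bar>f x \<bullet> g x\<bar> \<le> (norm (f x))\<^sup>2 + (norm (g x))\<^sup>2"
      using abs_ge_zero[of "f x \<bullet> g x"] by linarith
    then show "norm (f x \<bullet> g x) \<le> norm ((norm (f x))\<^sup>2 + (norm (g x))\<^sup>2)"
      by simp
  qed
  show "(\<lambda>x. f x \<bullet> g x) \<in> borel_measurable M" by measurable
qed

lemma integral_norm_add_sq:
  assumes "sq_integrable M f" "sq_integrable M g"
  shows "(\<integral>x. (norm (f x + r *\<^sub>R g x))\<^sup>2 \<partial>M) =
    (\<integral>x. (norm (f x))\<^sup>2 \<partial>M) + 2 * r * (\<integral>x. g x \<bullet> f x \<partial>M) + r\<^sup>2 * (\<integral>x. (norm (g x))\<^sup>2 \<partial>M)"
proof -
  have "(norm (f x + r *\<^sub>R g x))\<^sup>2 = (norm (f x))\<^sup>2 + 2 * r * (g x \<bullet> f x) + r\<^sup>2 * (norm (g x))\<^sup>2" for x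
    unfolding power2_norm_eq_inner
    by (simp add: inner_add_left inner_add_right inner_commute algebra_simps power2_eq_square)
  then show ?thesis
    using assms sq_integrable_inner[OF assms(2,1)] by (simp add: sq_integrable_def)
qed

text \<open>The squared increments, weighted by 2^k, have integrals at most 4 (1/8)^k, hence are
  summable almost everywhere. Their norms then decay like 2^(-k/2) pointwise, which gives pointwise
  convergence, and Fatou's lemma carries the Cauchy bounds over to the limit.\<close>

lemma L2_fast_Cauchy_limit:
  fixes g :: "nat \<Rightarrow> 'a \<Rightarrow> 'b::euclidean_space"
  assumes sq: "\<And>k. sq_integrable M (g k)"
    and Cauchy: "\<And>k l. k \<le> l \<Longrightarrow> (\<integral>x. (norm (g l x - g k x))\<^sup>2 \<partial>M) \<le> 4 * (1/16)^k"
  obtains G where "sq_integrable M G"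
    "\<And>k. (\<integral>x. (norm (G x - g k x))\<^sup>2 \<partial>M) \<le> 4 * (1/16)^k"
proof -
  have [measurable]: "g k \<in> borel_measurable M" for k
    using sq by (rule sq_integrable_measurable)
  have nn: "(\<integral>\<^sup>+x. ennreal ((norm (g l x - g k x))\<^sup>2) \<partial>M) \<le> ennreal (4 * (1/16)^k)" if "k \<le> l" for k l
  proof -
    have "(\<integral>\<^sup>+x. ennreal ((norm (g l x - g k x))\<^sup>2) \<partial>M) = ennreal (\<integral>x. (norm (g l x - g k x))\<^sup>2 \<partial>M)"
      using sq_integrable_diff[OF sq sq, of l k] by (intro nn_integral_eq_integral) (auto simp: sq_integrable_def)
    then show ?thesis using Cauchy[OF that] by (simp add: ennreal_leI)
  qed
  define d where "d k x = g (Suc k) x - g k x" for k x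
  have [measurable]: "d k \<in> borel_measurable M" for k unfolding d_def by measurable
  have "(\<integral>\<^sup>+x. (\<Sum>k. ennreal (2^k * (norm (d k x))\<^sup>2)) \<partial>M) = (\<Sum>k. \<integral>\<^sup>+x. ennreal (2^k * (norm (d k x))\<^sup>2) \<partial>M)"
    by (intro nn_integral_suminf) auto
  also have "\<dots> \<le> (\<Sum>k. ennreal (4 * (1/8)^k))"
  proof (intro suminf_le summableI)
    fix k
    have "(\<integral>\<^sup>+x. ennreal (2^k * (norm (d k x))\<^sup>2) \<partial>M) = ennreal (2^k) * (\<integral>\<^sup>+x. ennreal ((norm (d k x))\<^sup>2) \<partial>M)"
      by (simp add: ennreal_mult nn_integral_cmult)
    also have "\<dots> \<le> ennreal (2^k) * ennreal (4 * (1/16)^k)"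
      unfolding d_def by (intro mult_left_mono nn) auto
    also have "\<dots> = ennreal (4 * (1/8)^k)"
    proof -
      have "(2::real)^k * (1/16)^k = (1/8)^k" by (simp flip: power_mult_distrib)
      then show ?thesis by (simp add: mult.left_commute[of _ 4] flip: ennreal_mult)
    qed
    finally show "(\<integral>\<^sup>+x. ennreal (2^k * (norm (d k x))\<^sup>2) \<partial>M) \<le> ennreal (4 * (1/8)^k)" .
  qed
  also have "\<dots> < \<infinity>"
    by (subst suminf_ennreal2) (auto intro!: summable_mult summable_geometric)
  finally have "(\<integral>\<^sup>+x. (\<Sum>k. ennreal (2^k * (norm (d k x))\<^sup>2)) \<partial>M) \<noteq> \<infinity>" by simp
  then have "AE x in M. (\<Sum>k. ennreal (2^k * (norm (d k x))\<^sup>2)) \<noteq> \<infinity>"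
    by (intro nn_integral_noteq_infinite) auto
  then have conv: "AE x in M. convergent (\<lambda>k. g k x)"
  proof eventually_elim
    case (elim x)
    define S where "S = enn2real (\<Sum>k. ennreal (2^k * (norm (d k x))\<^sup>2))"
    have S: "(\<Sum>k. ennreal (2^k * (norm (d k x))\<^sup>2)) = ennreal S" "0 \<le> S"
      using elim by (auto simp: S_def less_top)
    have "2^k * (norm (d k x))\<^sup>2 \<le> S" for k
    proof -
      have "ennreal (2^k * (norm (d k x))\<^sup>2) \<le> (\<Sum>k. ennreal (2^k * (norm (d k x))\<^sup>2))"
        (is "?F k \<le> _")
      proof -
        have "sum ?F {k} \<le> suminf ?F" by (intro sum_le_suminf summableI) auto
        then show ?thesis by (simp only: sum.insert_if finite.emptyI sum.empty empty_iff if_False add_0_right)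
      qed
      then show ?thesis using S by (simp add: ennreal_le_iff)
    qed
    moreover have "(sqrt S * sqrt (1/2)^k)\<^sup>2 = S / 2^k" for k
    proof -
      have "(sqrt (1/2)^k)\<^sup>2 = ((sqrt (1/2))\<^sup>2)^k" by (simp only: power_mult[symmetric] mult.commute)
      then show ?thesis using S(2) by (simp add: power_mult_distrib power_divide)
    qed
    ultimately have "(norm (d k x))\<^sup>2 \<le> (sqrt S * sqrt (1/2)^k)\<^sup>2" for k
      by (simp add: pos_le_divide_eq mult.commute)
    then have le: "norm (d k x) \<le> sqrt S * sqrt (1/2)^k" for k
      by (rule power2_le_imp_le) (use S(2) in simp)
    have "summable (\<lambda>k. sqrt S * sqrt (1/2)^k)"
      by (intro summable_mult summable_geometric) (simp add: real_sqrt_divide)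
    then have "summable (\<lambda>k. d k x)"
      by (rule summable_comparison_test'[where N = 0]) (rule le)
    then have "convergent (\<lambda>n. \<Sum>k<n. d k x)" by (simp add: summable_iff_convergent)
    moreover have "(\<Sum>k<n. d k x) = g n x - g 0 x" for n
      unfolding d_def by (rule sum_lessThan_telescope)
    ultimately have "convergent (\<lambda>n. g n x - g 0 x)" by simp
    from convergent_add[OF this convergent_const[of "g 0 x"]] show ?case by simp
  qed
  define G where "G x = lim (\<lambda>k. g k x)" for x
  have [measurable]: "G \<in> borel_measurable M" unfolding G_def by measurable
  have lim: "AE x in M. (\<lambda>k. g k x) \<longlonglongrightarrow> G x"
    using conv by eventually_elim (simp add: G_def convergent_LIMSEQ_iff)
  have nnG: "(\<integral>\<^sup>+x. ennreal ((norm (G x - g k x))\<^sup>2) \<partial>M) \<le> ennreal (4 * (1/16)^k)" for k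
  proof -
    have "(\<integral>\<^sup>+x. ennreal ((norm (G x - g k x))\<^sup>2) \<partial>M) = (\<integral>\<^sup>+x. liminf (\<lambda>l. ennreal ((norm (g l x - g k x))\<^sup>2)) \<partial>M)"
    proof (rule nn_integral_cong_AE, use lim in eventually_elim)
      case (elim x)
      then have "(\<lambda>l. ennreal ((norm (g l x - g k x))\<^sup>2)) \<longlonglongrightarrow> ennreal ((norm (G x - g k x))\<^sup>2)"
        by (intro tendsto_intros)
      from lim_imp_Liminf[OF _ this] show ?case by simp
    qed
    also have "\<dots> \<le> liminf (\<lambda>l. \<integral>\<^sup>+x. ennreal ((norm (g l x - g k x))\<^sup>2) \<partial>M)"
      by (intro nn_integral_liminf) auto
    also have "\<dots> \<le> ennreal (4 * (1/16)^k)"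
    proof -
      have "\<forall>\<^sub>F l in sequentially. (\<integral>\<^sup>+x. ennreal ((norm (g l x - g k x))\<^sup>2) \<partial>M) \<le> ennreal (4 * (1/16)^k)"
        using nn by (intro eventually_sequentiallyI[of k]) auto
      from Limsup_bounded[OF this] show ?thesis
        using Liminf_le_Limsup[of sequentially] by (meson order_trans trivial_limit_sequentially)
    qed
    finally show ?thesis .
  qed
  have diff: "sq_integrable M (\<lambda>x. G x - g k x)" for k
    unfolding sq_integrable_def integrable_iff_bounded using order_le_less_trans[OF nnG[of k] ennreal_less_top] by simp
  show ?thesis
  proof
    show "sq_integrable M G" using sq_integrable_add[OF diff[of 0] sq[of 0]] by simp
    fix k
    have "ennreal (\<integral>x. (norm (G x - g k x))\<^sup>2 \<partial>M) \<le> ennreal (4 * (1/16)^k)"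
      using nnG[of k] diff[of k] by (subst nn_integral_eq_integral[symmetric]) (auto simp: sq_integrable_def)
    then show "(\<integral>x. (norm (G x - g k x))\<^sup>2 \<partial>M) \<le> 4 * (1/16)^k"
      by (simp add: ennreal_le_iff)
  qed
qed

text \<open>The representing function minimises \<open>\<parallel>g\<parallel>\<^sup>2 - 2 \<phi>(g)\<close>: a minimising sequence is Cauchy
  by the parallelogram law, and it satisfies the Euler equation up to a vanishing error.\<close>

theorem L2_Riesz_real:
  fixes \<phi> :: "('a \<Rightarrow> 'b::euclidean_space) \<Rightarrow> real"
  assumes add: "\<And>f g. sq_integrable M f \<Longrightarrow> sq_integrable M g \<Longrightarrow> \<phi> (\<lambda>x. f x + g x) = \<phi> f + \<phi> g"
    and scale: "\<And>f r. sq_integrable M f \<Longrightarrow> \<phi> (\<lambda>x. r *\<^sub>R f x) = r * \<phi> f"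
    and bound: "\<And>f. sq_integrable M f \<Longrightarrow> \<bar>\<phi> f\<bar> \<le> B * sqrt (\<integral>x. (norm (f x))\<^sup>2 \<partial>M)"
  obtains g where "sq_integrable M g" "\<And>f. sq_integrable M f \<Longrightarrow> \<phi> f = (\<integral>x. f x \<bullet> g x \<partial>M)"
proof -
  define N :: "('a \<Rightarrow> 'b) \<Rightarrow> real" where "N f = (\<integral>x. (norm (f x))\<^sup>2 \<partial>M)" for f
  define J where "J f = N f - 2 * \<phi> f" for f
  define m where "m = Inf (J ` {f. sq_integrable M f})"
  have zero: "sq_integrable M (\<lambda>x. 0)" by (simp add: sq_integrable_def)
  have N0: "N f \<ge> 0" for f unfolding N_def by simp
  have N_add: "N (\<lambda>x. f x + r *\<^sub>R g x) = N f + 2 * r * (\<integral>x. g x \<bullet> f x \<partial>M) + r\<^sup>2 * N g"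
    if "sq_integrable M f" "sq_integrable M g" for f g r
    unfolding N_def by (rule integral_norm_add_sq[OF that])
  have "J f \<ge> - B\<^sup>2" if "sq_integrable M f" for f
  proof -
    have "0 \<le> (sqrt (N f) - B)\<^sup>2" by simp
    then show ?thesis using bound[OF that] N0[of f] by (simp add: J_def power2_diff mult.commute mult.left_commute flip: N_def)
  qed
  then have bdd: "bdd_below (J ` {f. sq_integrable M f})" by (intro bdd_belowI2) auto
  have m_le: "m \<le> J f" if "sq_integrable M f" for f
    unfolding m_def using bdd that by (intro cInf_lower) auto
  have "\<exists>f. sq_integrable M f \<and> J f < m + (1/16)^k" for k :: nat
    using cInf_lessD[of "J ` {f. sq_integrable M f}" "m + (1/16)^k"] zero by (auto simp: m_def)
  then obtain g where g: "\<And>k::nat. sq_integrable M (g k)" "\<And>k. J (g k) < m + (1/16)^k" by metis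
  have Cauchy: "N (\<lambda>x. g l x - g k x) \<le> 4 * (1/16)^k" if "k \<le> l" for k l
  proof -
    \<comment> \<open>The midpoint competes with the minimum. In the parallelogram identity the
      linear parts of \<open>J\<close> cancel, so the distance of \<open>g k\<close> and
      \<open>g l\<close> is controlled by their excess over \<open>m\<close> alone.\<close>
    define h where "h x = (1/2) *\<^sub>R (g k x + 1 *\<^sub>R g l x)" for x
    have sum: "sq_integrable M (\<lambda>x. g k x + 1 *\<^sub>R g l x)"
      using g(1) by (auto intro: sq_integrable_add)
    have h: "sq_integrable M h" unfolding h_def by (rule sq_integrable_scale[OF sum])
    have "N h = (1/4) * N (\<lambda>x. g k x + 1 *\<^sub>R g l x)"
      unfolding N_def h_def by (simp add: power_mult_distrib power_divide)
    moreover have "\<phi> h = (1/2) * (\<phi> (g k) + \<phi> (g l))"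
      unfolding h_def scale[OF sum] using add[OF g(1) g(1), of k l] by simp
    moreover have "N (\<lambda>x. g l x - g k x) = N (\<lambda>x. g l x + (-1) *\<^sub>R g k x)" by simp
    ultimately have "N (\<lambda>x. g l x - g k x) = 2 * J (g k) + 2 * J (g l) - 4 * J h"
      unfolding J_def N_add[OF g(1) g(1)] by (simp add: inner_commute algebra_simps)
    also have "\<dots> \<le> 2 * (1/16)^k + 2 * (1/16)^l"
      using g(2)[of k] g(2)[of l] m_le[OF h] by linarith
    also have "\<dots> \<le> 4 * (1/16)^k"
    proof -
      have "(1/16::real)^l \<le> (1/16)^k" using that by (intro power_decreasing) auto
      then show ?thesis by linarith
    qed
    finally show ?thesis .
  qed
  obtain G where G: "sq_integrable M G" "\<And>k. N (\<lambda>x. G x - g k x) \<le> 4 * (1/16)^k"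
    unfolding N_def using L2_fast_Cauchy_limit[OF g(1) Cauchy[unfolded N_def]] by blast
  have "\<phi> f = (\<integral>x. f x \<bullet> G x \<partial>M)" if f: "sq_integrable M f" for f
  proof -
    have "\<bar>(\<integral>x. f x \<bullet> G x \<partial>M) - \<phi> f\<bar> \<le> (1/4)^k * (3 + N f)" for k :: nat
    proof -
      \<comment> \<open>The square root of the minimality defect (1/16)^k. Perturbing by r = e and r
        = -e and dividing by \<open>e\<close> leaves an Euler equation with error of order
        \<open>e\<close>; the same \<open>e\<close> is the weight in the comparison of
        \<open>G\<close> with \<open>g k\<close>.\<close>
      let ?e = "(1/4::real)^k"
      let ?I = "\<integral>x. f x \<bullet> g k x \<partial>M"
      have e: "?e > 0" "(1/16)^k = ?e\<^sup>2" by (simp, simp only: power2_eq_square power_mult_distrib[symmetric]) simp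
      have Euler: "0 \<le> ?e\<^sup>2 + 2 * r * (?I - \<phi> f) + r\<^sup>2 * N f" for r
      proof -
        have "m \<le> J (\<lambda>x. g k x + r *\<^sub>R f x)"
          using f g(1) by (intro m_le sq_integrable_add sq_integrable_scale)
        also have "\<dots> = J (g k) + 2 * r * (?I - \<phi> f) + r\<^sup>2 * N f"
          unfolding J_def N_add[OF g(1) f] add[OF g(1) sq_integrable_scale[OF f]] scale[OF f]
          by (simp add: algebra_simps)
        finally show ?thesis using g(2)[of k] e by linarith
      qed
      have 1: "2 * \<bar>?I - \<phi> f\<bar> \<le> ?e + ?e * N f"
      proof -
        have "?e * (2 * \<bar>?I - \<phi> f\<bar>) \<le> ?e * (?e + ?e * N f)"
          using Euler[of ?e] Euler[of "-?e"] by (auto simp: abs_if algebra_simps power2_eq_square)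
        then show ?thesis using e by simp
      qed
      have d: "sq_integrable M (\<lambda>x. G x - g k x)" using G g by (intro sq_integrable_diff)
      have 2: "2 * \<bar>(\<integral>x. f x \<bullet> G x \<partial>M) - ?I\<bar> \<le> 4 * ?e + ?e * N f"
      proof -
        have "(\<integral>x. f x \<bullet> G x \<partial>M) - ?I = (\<integral>x. (G x - g k x) \<bullet> f x \<partial>M)"
        proof -
          have "(G x - g k x) \<bullet> f x = f x \<bullet> G x - f x \<bullet> g k x" for x
            unfolding inner_diff_left by (simp only: inner_commute)
          then show ?thesis
            using sq_integrable_inner[OF f G(1)] sq_integrable_inner[OF f g(1)[of k]] by simp
        qed
        then have "2 * \<bar>(\<integral>x. f x \<bullet> G x \<partial>M) - ?I\<bar> \<le> (\<integral>x. 2 * \<bar>(G x - g k x) \<bullet> f x\<bar> \<partial>M)"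
          using integral_abs_bound[of M "\<lambda>x. (G x - g k x) \<bullet> f x"] by simp
        also have "\<dots> \<le> (\<integral>x. (norm (G x - g k x))\<^sup>2 / ?e + ?e * (norm (f x))\<^sup>2 \<partial>M)"
          using d f e(1) sq_integrable_inner[OF d f]
          by (intro integral_mono two_abs_inner_le) (auto simp: sq_integrable_def)
        also have "\<dots> = N (\<lambda>x. G x - g k x) / ?e + ?e * N f"
          using d f by (simp add: N_def sq_integrable_def)
        also have "N (\<lambda>x. G x - g k x) / ?e \<le> 4 * ?e"
          using G(2)[of k] e by (simp add: field_simps power2_eq_square)
        finally show ?thesis by simp
      qed
      \<comment> \<open>Half of each of the two bounds gives 5/2 * e + e * N f; the constant is
        rounded up to 3.\<close>
      have eq: "?e * (3 + N f) = 3 * ?e + ?e * N f" by (simp add: distrib_left)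
      have triangle: "\<bar>a - c\<bar> \<le> 3 * e + n"
        if "2 * \<bar>b - c\<bar> \<le> e + n" "2 * \<bar>a - b\<bar> \<le> 4 * e + n" "0 < e" for a b c e n :: real
        using that by (smt (verit))
      show ?thesis unfolding eq by (rule triangle[OF 1 2 e(1)])
    qed
    then have le: "\<exists>K. \<forall>k\<ge>K. \<bar>(\<integral>x. f x \<bullet> G x \<partial>M) - \<phi> f\<bar> \<le> (1/4)^k * (3 + N f)" by blast
    have "(\<lambda>k. (1/4::real)^k * (3 + N f)) \<longlonglongrightarrow> 0 * (3 + N f)"
      by (intro tendsto_intros LIMSEQ_power_zero) auto
    from LIMSEQ_le_const[OF this le] have "\<bar>(\<integral>x. f x \<bullet> G x \<partial>M) - \<phi> f\<bar> \<le> 0" by simp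
    then show ?thesis by simp
  qed
  with G(1) that show ?thesis by blast
qed

section \<open>The Hermitian product on complex vectors and the complex Riesz theorem\<close>

lemma continuous_on_scalar_mult_vec: "continuous_on UNIV (\<lambda>u::complex^'m. a *s u)"
  unfolding vector_scalar_mult_def by (intro continuous_intros)

lemma measurable_scalar_mult_vec [measurable]:
  fixes f :: "'a \<Rightarrow> complex^'m"
  assumes "f \<in> borel_measurable M"
  shows "(\<lambda>x. a *s f x) \<in> borel_measurable M"
  using measurable_compose[OF assms borel_measurable_continuous_onI[OF continuous_on_scalar_mult_vec]] .

lemma measurable_cinner [measurable]:
  fixes f g :: "'a \<Rightarrow> complex^'m"
  assumes [measurable]: "f \<in> borel_measurable M" "g \<in> borel_measurable M"
  shows "(\<lambda>x. cinner (f x) (g x)) \<in> borel_measurable M"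
proof -
  have nth: "(\<lambda>x. h x $ i) \<in> borel_measurable M" if "h \<in> borel_measurable M" for h :: "'a \<Rightarrow> complex^'m" and i
    using measurable_compose[OF that borel_measurable_continuous_onI[of "\<lambda>u. u $ i"]]
    by (simp add: continuous_on_component continuous_on_id)
  have [measurable]: "(\<lambda>x. f x $ i) \<in> borel_measurable M" "(\<lambda>x. cnj (g x $ i)) \<in> borel_measurable M" for i
    using nth measurable_compose[OF nth[OF assms(2)] borel_measurable_continuous_onI[of cnj]]
    by (auto intro!: continuous_intros)
  show ?thesis unfolding cinner_def by measurable
qed

lemma norm_cinner_le: "norm (cinner u v) \<le> norm u * norm v"
proof -
  have "norm (cinner u v) \<le> (\<Sum>i\<in>UNIV. \<bar>norm (u $ i)\<bar> * \<bar>norm (v $ i)\<bar>)"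
    unfolding cinner_def by (intro sum_norm_le) (simp add: norm_mult)
  also have "\<dots> \<le> norm u * norm v"
    unfolding norm_vec_def by (rule L2_set_mult_ineq)
  finally show ?thesis .
qed

lemma Re_cinner: "Re (cinner u v) = u \<bullet> v"
  by (simp add: cinner_def inner_vec_def inner_complex_def)

lemma cinner_self: "cinner u u = complex_of_real ((norm u)\<^sup>2)"
proof -
  have "Im (cinner u u) = 0" by (simp add: cinner_def)
  then show ?thesis by (simp add: complex_eq_iff Re_cinner power2_norm_eq_inner)
qed

lemma cinner_add_left: "cinner (u + v) w = cinner u w + cinner v w"
  by (simp add: cinner_def ring_distribs sum.distrib)

lemma cinner_diff_right: "cinner u (v - w) = cinner u v - cinner u w"
  by (simp add: cinner_def ring_distribs sum_subtractf)

lemma cinner_scale_left: "cinner (a *s u) w = a * cinner u w"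
  by (simp add: cinner_def sum_distrib_left mult.assoc)

lemma norm_scalar_mult_vec: "norm (a *s (u::complex^'m)) = norm a * norm u"
  by (simp add: norm_vec_def norm_mult L2_set_right_distrib)

lemma sq_integrable_smult:
  fixes f :: "'a \<Rightarrow> complex^'m"
  shows "sq_integrable M f \<Longrightarrow> sq_integrable M (\<lambda>x. a *s f x)"
  by (auto simp: sq_integrable_def norm_scalar_mult_vec power_mult_distrib)

lemma sq_integrable_cinner:
  fixes f g :: "'a \<Rightarrow> complex^'m"
  assumes "sq_integrable M f" "sq_integrable M g"
  shows "integrable M (\<lambda>x. cinner (f x) (g x))"
proof (rule Bochner_Integration.integrable_bound)
  note [measurable] = assms[THEN sq_integrable_measurable]
  show "integrable M (\<lambda>x. (norm (f x))\<^sup>2 + (norm (g x))\<^sup>2)"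
    using assms by (auto simp: sq_integrable_def)
  show "AE x in M. norm (cinner (f x) (g x)) \<le> norm ((norm (f x))\<^sup>2 + (norm (g x))\<^sup>2)"
  proof (rule AE_I2)
    fix x
    have "2 * (norm (f x) * norm (g x)) \<le> (norm (f x))\<^sup>2 + (norm (g x))\<^sup>2"
      using sum_squares_bound[of "norm (f x)" "norm (g x)"] by simp
    moreover have "0 \<le> norm (f x) * norm (g x)" by simp
    ultimately have "norm (cinner (f x) (g x)) \<le> (norm (f x))\<^sup>2 + (norm (g x))\<^sup>2"
      using norm_cinner_le[of "f x" "g x"] by linarith
    then show "norm (cinner (f x) (g x)) \<le> norm ((norm (f x))\<^sup>2 + (norm (g x))\<^sup>2)" by simp
  qed
  show "(\<lambda>x. cinner (f x) (g x)) \<in> borel_measurable M" by measurable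
qed

text \<open>The real part of \<open>cinner\<close> is the real inner product of the underlying real
  space, so the real theorem represents \<open>Re (F f)\<close>. Replacing \<open>f\<close> by \<i>
  times \<open>f\<close> turns the real part into minus the imaginary part on both sides, which
  recovers \<open>Im (F f)\<close> with the same representative.\<close>

theorem L2_Riesz_complex:
  fixes F :: "('a \<Rightarrow> complex^'m) \<Rightarrow> complex"
  assumes lin: "\<And>f g a b. sq_integrable M f \<Longrightarrow> sq_integrable M g \<Longrightarrow>
      F (\<lambda>x. a *s f x + b *s g x) = a * F f + b * F g"
    and bound: "\<And>f. sq_integrable M f \<Longrightarrow> norm (F f) \<le> B * sqrt (\<integral>x. (norm (f x))\<^sup>2 \<partial>M)"
  obtains g where "sq_integrable M g" "\<And>f. sq_integrable M f \<Longrightarrow> F f = (\<integral>x. cinner (f x) (g x) \<partial>M)"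
proof -
  have smult: "F (\<lambda>x. a *s f x) = a * F f" if "sq_integrable M f" for f a
    using lin[OF that that, of a 0] by simp
  obtain g where g: "sq_integrable M g" "\<And>f. sq_integrable M f \<Longrightarrow> Re (F f) = (\<integral>x. f x \<bullet> g x \<partial>M)"
  proof (rule L2_Riesz_real[where \<phi> = "\<lambda>f. Re (F f)" and M = M and B = B])
    show "Re (F (\<lambda>x. f x + g x)) = Re (F f) + Re (F g)" if "sq_integrable M f" "sq_integrable M g" for f g
      using lin[OF that, of 1 1] by simp
    show "Re (F (\<lambda>x. r *\<^sub>R f x)) = r * Re (F f)" if "sq_integrable M f" for f r
    proof -
      have "(\<lambda>x. r *\<^sub>R f x) = (\<lambda>x. complex_of_real r *s f x)"
        by (simp add: fun_eq_iff vec_eq_iff scaleR_conv_of_real[where 'a=complex])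
      then show ?thesis using smult[OF that, of "complex_of_real r"] by simp
    qed
    show "\<bar>Re (F f)\<bar> \<le> B * sqrt (\<integral>x. (norm (f x))\<^sup>2 \<partial>M)" if "sq_integrable M f" for f
      using bound[OF that] abs_Re_le_cmod[of "F f"] by linarith
  qed blast
  have "F f = (\<integral>x. cinner (f x) (g x) \<partial>M)" if f: "sq_integrable M f" for f
  proof (rule complex_eqI)
    have int: "integrable M (\<lambda>x. cinner (f x) (g x))" by (rule sq_integrable_cinner[OF f g(1)])
    show "Re (F f) = Re (\<integral>x. cinner (f x) (g x) \<partial>M)"
      using g(2)[OF f] int by (simp add: Re_cinner flip: integral_Re)
    have "(\<i> *s f x) \<bullet> g x = - Im (cinner (f x) (g x))" for x
      unfolding Re_cinner[symmetric] cinner_scale_left by simp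
    then show "Im (F f) = Im (\<integral>x. cinner (f x) (g x) \<partial>M)"
      using g(2)[OF sq_integrable_smult[OF f, of \<i>]] smult[OF f, of \<i>] int by (simp flip: integral_Im)
  qed
  with g(1) that show ?thesis by blast
qed

section \<open>Whitney cells\<close>

lemma emeasure_cylinder:
  fixes x :: "real^'n"
  assumes "a \<le> b" "0 \<le> \<rho>"
  shows "emeasure lebesgue ({a<..<b} \<times> ball x \<rho>) =
    ennreal ((b - a) * (unit_ball_vol (real CARD('n)) * \<rho> ^ CARD('n)))"
proof -
  have "emeasure lebesgue ({a<..<b} \<times> ball x \<rho>) = emeasure (lborel \<Otimes>\<^sub>M lborel) ({a<..<b} \<times> ball x \<rho>)"
  proof -
    have "{a<..<b} \<times> ball x \<rho> \<in> sets borel" by (intro borel_open open_Times) auto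
    then show ?thesis by (simp add: lborel_prod)
  qed
  also have "\<dots> = emeasure lborel {a<..<b} * emeasure lborel (ball x \<rho>)"
    by (intro lborel.emeasure_pair_measure_Times) auto
  also have "\<dots> = ennreal ((b - a) * (unit_ball_vol (real CARD('n)) * \<rho> ^ CARD('n)))"
    using assms by (simp add: emeasure_ball ennreal_mult)
  finally show ?thesis .
qed

lemma whitney_region_eq_cylinder:
  "whitney_region c z = {fst z / snd c<..<snd c * fst z} \<times> ball (snd z) (fst c * fst z)"
  by (auto simp: whitney_region_def dist_commute)

text \<open>The volume of the Whitney region of a point at height 1 in dimension n + 1; dilation
  multiplies it by t^(n+1) at height t.\<close>

definition whitney_vol :: "nat \<Rightarrow> real \<times> real \<Rightarrow> real" where
  "whitney_vol n c = (snd c - 1 / snd c) * (unit_ball_vol (real n) * fst c ^ n)"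

lemma whitney_vol_pos: "fst c > 0 \<Longrightarrow> snd c > 1 \<Longrightarrow> whitney_vol n c > 0"
  by (auto simp: whitney_vol_def field_simps intro!: mult_pos_pos less_1_mult)

lemma emeasure_whitney_region:
  fixes z :: "real \<times> (real^'n)"
  assumes "fst c > 0" "snd c > 1" "fst z > 0"
  shows "emeasure lebesgue (whitney_region c z) =
    ennreal (whitney_vol CARD('n) c * fst z powr (real CARD('n) + 1))"
proof -
  have le: "fst z / snd c \<le> snd c * fst z"
  proof -
    have "fst z / snd c \<le> fst z" using assms by (simp add: field_simps)
    also have "\<dots> \<le> snd c * fst z" using assms by simp
    finally show ?thesis .
  qed
  have "(snd c * fst z - fst z / snd c) * (unit_ball_vol (real CARD('n)) * (fst c * fst z) ^ CARD('n))
    = whitney_vol CARD('n) c * fst z powr (real CARD('n) + 1)"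
    using assms by (simp add: whitney_vol_def powr_add powr_realpow power_mult_distrib algebra_simps)
  then show ?thesis
    unfolding whitney_region_eq_cylinder using emeasure_cylinder[OF le, of "fst c * fst z" "snd z"] assms by simp
qed

lemma whitney_region_sets [measurable]: "whitney_region c z \<in> sets borel"
proof -
  have "open (whitney_region c z)"
    unfolding whitney_region_eq_cylinder by (intro open_Times) auto
  then show ?thesis by simp
qed

lemma borel_measurable_snd_nth [measurable]:
  "(\<lambda>z :: real \<times> (real^'n). snd z $ i) \<in> borel_measurable borel"
  by (intro borel_measurable_continuous_onI continuous_intros)

lemma borel_measurable_fst_half [measurable]:
  "(\<lambda>z :: real \<times> (real^'n). fst z) \<in> borel_measurable borel"
  by (intro borel_measurable_continuous_onI continuous_intros)

text \<open>The cells are the fibres of \<open>ix\<close> in the half-space. The dimension \<open>D\<close> is a parameter because the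
  constants below would otherwise pick up a hidden type argument.\<close>

locale whitney_cover =
  fixes c :: "real \<times> real" and ix :: "real \<times> (real^'n) \<Rightarrow> nat" and T :: "nat \<Rightarrow> real" and v :: real and D :: nat
  assumes c: "whitney_param c"
    and D: "D = CARD('n)"
    and ix [measurable]: "ix \<in> measurable borel (count_space UNIV)"
    and T_pos: "\<And>i. T i > 0"
    and v_pos: "v > 0"
    and T_le: "\<And>z. fst z > 0 \<Longrightarrow> T (ix z) \<le> fst z"
    and le_T: "\<And>z. fst z > 0 \<Longrightarrow> fst z \<le> 3/2 * T (ix z)"
    and dist_ix: "\<And>z w. fst z > 0 \<Longrightarrow> fst w > 0 \<Longrightarrow> ix z = ix w \<Longrightarrow> dist (snd w) (snd z) < fst c * fst z"
    and cell_vol: "\<And>i. ennreal (v * T i powr (real D + 1)) \<le> emeasure lebesgue {z. fst z > 0 \<and> ix z = i}"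

text \<open>The layers are the height intervals from (3/2)^j to (3/2)^(j+1), and each layer is cut
  horizontally into cubes whose side is proportional to (3/2)^j. A bijection with the naturals
  enumerates the pairs of a layer and an integer lattice point.\<close>

theorem whitney_cover_exists:
  assumes "whitney_param c"
  shows "\<exists>(ix :: real \<times> (real^'n) \<Rightarrow> nat) T v. whitney_cover c ix T v CARD('n)"
proof -
  define n where "n = real CARD('n)"
  have n: "n > 0" unfolding n_def by simp
  have c: "fst c > 0" "snd c > 3/2" using assms by (auto simp: whitney_param_def)
  \<comment> \<open>The Euclidean distance is estimated by the sum of the n coordinate distances,
    each below the side of the cube, so dividing by n keeps the total below \<open>fst c\<close>
    times the height.\<close>
  define \<delta> where "\<delta> = fst c / n"
  have \<delta>: "\<delta> > 0" using c n by (simp add: \<delta>_def)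
  define R where "R j = (3/2) powr real_of_int j" for j
  have R: "R j > 0" for j by (simp add: R_def)
  define J :: "real \<times> (real^'n) \<Rightarrow> int" where "J z = \<lfloor>log (3/2) (fst z)\<rfloor>" for z
  define K :: "real \<times> (real^'n) \<Rightarrow> 'n \<Rightarrow> int" where "K z l = \<lfloor>snd z $ l / (\<delta> * R (J z))\<rfloor>" for z l
  have "infinite (UNIV :: (int \<times> ('n \<Rightarrow> int)) set)"
  proof
    assume "finite (UNIV :: (int \<times> ('n \<Rightarrow> int)) set)"
    then have "finite (fst ` (UNIV :: (int \<times> ('n \<Rightarrow> int)) set))" by (rule finite_imageI)
    then show False by (simp add: infinite_UNIV_int)
  qed
  then obtain e :: "int \<times> ('n \<Rightarrow> int) \<Rightarrow> nat" where e: "bij e"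
    using countableE_infinite[of "UNIV :: (int \<times> ('n \<Rightarrow> int)) set"] by blast
  define ix where "ix z = e (J z, K z)" for z
  define T where "T i = R (fst (inv e i))" for i
  \<comment> \<open>The volume of a cylinder inscribed in the cell of scale 1: its height is 3/2 - 1
    and its radius is half the side of the cube.\<close>
  define v where "v = 1/2 * (unit_ball_vol n * (\<delta>/2) ^ CARD('n))"
  have ix_eq: "ix z = i \<longleftrightarrow> J z = fst (inv e i) \<and> K z = snd (inv e i)" for z i
  proof -
    have "ix z = i \<longleftrightarrow> (J z, K z) = inv e i"
      unfolding ix_def using e by (metis bij_inv_eq_iff)
    then show ?thesis by (metis fst_conv snd_conv prod.collapse)
  qed
  \<comment> \<open>Here the grid size no longer depends on \<open>z\<close> but on the fixed index
    \<open>i\<close>; in this form the fibres of \<open>ix\<close> are visibly Borel.\<close>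
  have ix_floor: "ix z = i \<longleftrightarrow> \<lfloor>log (3/2) (fst z)\<rfloor> = fst (inv e i) \<and>
      (\<forall>l. \<lfloor>snd z $ l / (\<delta> * R (fst (inv e i)))\<rfloor> = snd (inv e i) l)" for z i
    unfolding ix_eq fun_eq_iff K_def by (auto simp: J_def)
  have T_ix: "T (ix z) = R (J z)" for z
    unfolding T_def using ix_eq[of z "ix z"] by simp
  have J_iff: "J z = j \<longleftrightarrow> R j \<le> fst z \<and> fst z < 3/2 * R j" if "fst z > 0" for z j
  proof -
    have "3/2 * R j = (3/2) powr (real_of_int j + 1)" by (simp add: R_def powr_add)
    then show ?thesis
      using that unfolding J_def floor_eq_iff R_def by (simp add: le_log_iff log_less_iff)
  qed
  have K_iff: "K z l = k \<longleftrightarrow> \<delta> * R (J z) * k \<le> snd z $ l \<and> snd z $ l < \<delta> * R (J z) * (k + 1)" for z l k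
    unfolding K_def floor_eq_iff using \<delta> R[of "J z"] by (simp add: field_simps)
  show ?thesis
  proof (intro exI)
    show "whitney_cover c ix T v CARD('n)"
    proof
      show "CARD('n) = CARD('n)" ..
      show "whitney_param c" by fact
      show "ix \<in> borel \<rightarrow>\<^sub>M count_space UNIV"
      proof -
        have "ix -` {i} \<inter> space borel \<in> sets borel" for i
        proof -
          have "ix -` {i} \<inter> space borel =
            {z. \<lfloor>log (3/2) (fst z)\<rfloor> = fst (inv e i) \<and>
              (\<forall>l. \<lfloor>snd z $ l / (\<delta> * R (fst (inv e i)))\<rfloor> = snd (inv e i) l)}"
            by (auto simp only: ix_floor[symmetric]) auto
          also have "\<dots> \<in> sets borel" by measurable
          finally show ?thesis .
        qed
        then show ?thesis by (simp add: measurable_count_space_eq2_countable)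
      qed
      show "T i > 0" for i by (simp add: T_def R)
      show "v > 0" unfolding v_def using \<delta> n by (intro mult_pos_pos) auto
      fix z :: "real \<times> (real^'n)"
      assume z: "fst z > 0"
      show zT: "T (ix z) \<le> fst z" "fst z \<le> 3/2 * T (ix z)"
        using J_iff[OF z, of "J z"] by (auto simp: T_ix)
      fix w :: "real \<times> (real^'n)"
      assume w: "fst w > 0" and eq: "ix z = ix w"
      have J: "J z = J w" and K: "K z = K w" using ix_eq[of z "ix w"] ix_eq[of w "ix w"] eq by auto
      have "dist (snd w) (snd z) \<le> (\<Sum>l\<in>UNIV. \<bar>(snd w - snd z) $ l\<bar>)"
        unfolding dist_norm by (rule norm_le_l1_cart)
      also have "\<dots> < (\<Sum>l\<in>(UNIV::'n set). \<delta> * R (J z))"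
      proof (intro sum_strict_mono)
        fix l
        show "\<bar>(snd w - snd z) $ l\<bar> < \<delta> * R (J z)"
          using K_iff[of z l "K z l"] K_iff[of w l "K z l"] unfolding J K
          by (auto simp: algebra_simps abs_less_iff)
      qed auto
      also have "\<dots> = fst c * R (J z)" using n by (simp add: \<delta>_def n_def)
      also have "\<dots> \<le> fst c * fst z" using c zT by (simp add: T_ix)
      finally show "dist (snd w) (snd z) < fst c * fst z" .
    next
      fix i
      define j where "j = fst (inv e i)"
      define k where "k = snd (inv e i)"
      define ctr where "ctr = (\<chi> l. \<delta> * R j * (real_of_int (k l) + 1/2))"
      have "{R j<..<3/2 * R j} \<times> ball ctr (\<delta> * R j / 2) \<subseteq> {z. fst z > 0 \<and> ix z = i}"
      proof (clarify)
        fix t and x :: "real^'n"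
        assume t: "t \<in> {R j<..<3/2 * R j}" and x: "x \<in> ball ctr (\<delta> * R j / 2)"
        have t0: "t > 0" using t R[of j] by auto
        have J: "J (t, x) = j" using J_iff[of "(t,x)" j] t t0 by auto
        have "K (t, x) l = k l" for l
        proof -
          have "\<bar>(ctr - x) $ l\<bar> < \<delta> * R j / 2"
            using component_le_norm_cart[of "ctr - x" l] x by (simp add: dist_norm)
          moreover have "(ctr - x) $ l = \<delta> * R j * real_of_int (k l) + \<delta> * R j / 2 - x $ l"
            by (simp add: ctr_def distrib_left)
          ultimately have "\<delta> * R j * real_of_int (k l) \<le> x $ l"
            "x $ l < \<delta> * R j * real_of_int (k l) + \<delta> * R j"
            by (simp_all only: abs_less_iff) linarith+
          then show ?thesis unfolding K_iff J by (simp add: distrib_left)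
        qed
        then show "fst (t, x) > 0 \<and> ix (t, x) = i"
          using t0 J by (auto simp: ix_eq j_def k_def fun_eq_iff)
      qed
      moreover have "{z. fst z > 0 \<and> ix z = i} \<in> sets lebesgue"
      proof -
        have "{z. fst z > 0 \<and> ix z = i} = {z. fst z > 0 \<and> \<lfloor>log (3/2) (fst z)\<rfloor> = j \<and>
            (\<forall>l. \<lfloor>snd z $ l / (\<delta> * R j)\<rfloor> = k l)}"
          unfolding j_def k_def ix_floor ..
        also have "\<dots> \<in> sets borel" by measurable
        finally show ?thesis by simp
      qed
      ultimately have "emeasure lebesgue ({R j<..<3/2 * R j} \<times> ball ctr (\<delta> * R j / 2)) \<le> emeasure lebesgue {z. fst z > 0 \<and> ix z = i}"
        by (intro emeasure_mono)
      moreover have "emeasure lebesgue ({R j<..<3/2 * R j} \<times> ball ctr (\<delta> * R j / 2)) = ennreal (v * T i powr (real CARD('n) + 1))"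
        using R[of j] \<delta> by (subst emeasure_cylinder)
          (auto simp: v_def T_def powr_add powr_realpow power_mult_distrib power_divide n_def j_def algebra_simps intro!: arg_cong[of _ _ ennreal])
      ultimately show "ennreal (v * T i powr (real CARD('n) + 1)) \<le> emeasure lebesgue {z. fst z > 0 \<and> ix z = i}" by simp
    qed
  qed
qed

section \<open>The measure dx dt/t on the half-space\<close>

lemma upper_half_sets [measurable]: "upper_half \<in> sets (borel :: (real \<times> (real^'n)) measure)"
  unfolding upper_half_def by measurable

lemma sets_half_measure [measurable_cong]: "sets half_measure = sets lebesgue"
  by (simp add: half_measure_def)

lemma space_half_measure [simp]: "space half_measure = UNIV"
  by (simp add: half_measure_def)

lemma lebesgue_fst_measurable [measurable]: "(\<lambda>z :: real \<times> (real^'n). fst z) \<in> borel_measurable lebesgue"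
  by (rule measurable_completion) simp

lemma half_density_measurable [measurable]:
  "(\<lambda>z :: real \<times> (real^'n). indicator upper_half z * ennreal (1 / fst z)) \<in> borel_measurable lebesgue"
proof -
  have "(\<lambda>z :: real \<times> (real^'n). indicator upper_half z * ennreal (1 / fst z)) \<in> borel_measurable borel"
    by measurable
  then show ?thesis by (intro measurable_completion) simp
qed

lemma AE_half_measure_pos: "AE z in (half_measure :: (real \<times> (real^'n)) measure). fst z > 0"
  unfolding half_measure_def AE_density[OF half_density_measurable]
  by (intro AE_I2) (auto simp: upper_half_def indicator_def)

lemma nn_integral_half_measure:
  assumes "f \<in> borel_measurable lebesgue"
  shows "(\<integral>\<^sup>+z. f z \<partial>half_measure) = (\<integral>\<^sup>+z. (indicator upper_half z * ennreal (1 / fst z)) * f z \<partial>(lebesgue :: (real \<times> (real^'n)) measure))"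
  unfolding half_measure_def by (rule nn_integral_density[OF half_density_measurable assms])

section \<open>Geometry of cells and their neighbourhoods\<close>

context whitney_cover
begin

abbreviation N :: real where "N \<equiv> real D"

lemma emeasure_region:
  fixes z :: "real \<times> (real^'n)"
  assumes "fst k > 0" "snd k > 1" "fst z > 0"
  shows "emeasure lebesgue (whitney_region k z) = ennreal (whitney_vol D k * fst z powr (N + 1))"
  unfolding D by (rule emeasure_whitney_region[OF assms])

definition cell :: "nat \<Rightarrow> (real \<times> (real^'n)) set" where
  "cell i = {z. fst z > 0 \<and> ix z = i}"

lemma cell_borel: "cell i \<in> sets borel"
  unfolding cell_def by measurable

lemma cell_sets [measurable]: "cell i \<in> sets lebesgue"
  using cell_borel by simp

lemma c_pos: "fst c > 0" "snd c > 3/2" "snd c > 1" "snd c > 0"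
  using c by (auto simp: whitney_param_def)

lemma disjoint_cell: "disjoint_family cell"
  by (auto simp: disjoint_family_on_def cell_def)

lemma cell_ix: "fst z > 0 \<Longrightarrow> z \<in> cell (ix z)"
  by (simp add: cell_def)

lemma cell_nonempty: "cell i \<noteq> {}"
proof
  assume "cell i = {}"
  then have "ennreal (v * T i powr (N + 1)) \<le> 0" using cell_vol[of i, folded cell_def] by simp
  moreover have "0 < v * T i powr (N + 1)" using v_pos T_pos[of i] by simp
  ultimately show False by (simp add: ennreal_eq_0_iff)
qed

definition base_point :: "nat \<Rightarrow> real \<times> (real^'n)" where
  "base_point i = (SOME z. z \<in> cell i)"

lemma base_point_cell: "base_point i \<in> cell i"
  unfolding base_point_def using cell_nonempty by (simp add: some_in_eq)

text \<open>Contains every point whose Whitney region meets the cell (\<open>mem_nbhdI\<close>). It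
  is taken as one enlarged Whitney region, not as the exact set of those points, so that its
  measurability and volume are immediate. Vertically 3/2 * \<open>snd c\<close> is rounded up to 2 *
  \<open>snd c\<close>; horizontally the summand 1 is the radius of the cell seen from the base
  point, and 2 * \<open>snd c\<close> that of the region, rescaled to the base height.\<close>

definition nbhd :: "nat \<Rightarrow> (real \<times> (real^'n)) set" where
  "nbhd i = whitney_region (fst c * (1 + 2 * snd c), 2 * snd c) (base_point i)"

lemma nbhd_sets [measurable]: "nbhd i \<in> sets lebesgue"
  unfolding nbhd_def using whitney_region_sets by simp

text \<open>The factor 2 * \<open>snd c\<close> between a neighbourhood point and the base point,
  times the factor 3/2 between the base point and \<open>T i\<close>.\<close>

definition \<Lambda> :: real where "\<Lambda> = 3 * snd c"

lemma \<Lambda>_pos: "\<Lambda> > 1" "\<Lambda> > 0"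
  using c_pos by (auto simp: \<Lambda>_def)

lemma cell_bounds:
  assumes "z \<in> cell i"
  shows "fst z > 0" "T i \<le> fst z" "fst z \<le> 3/2 * T i" "fst z \<le> \<Lambda> * T i" "T i \<le> \<Lambda> * fst z"
proof -
  show *: "fst z > 0" "T i \<le> fst z" "fst z \<le> 3/2 * T i"
    using assms T_le[of z] le_T[of z] by (auto simp: cell_def)
  have "3/2 * T i \<le> \<Lambda> * T i" using c_pos T_pos[of i] by (intro mult_right_mono) (auto simp: \<Lambda>_def)
  then show "fst z \<le> \<Lambda> * T i" using * by linarith
  have "1 * fst z \<le> \<Lambda> * fst z" using \<Lambda>_pos * by (intro mult_right_mono) auto
  then show "T i \<le> \<Lambda> * fst z" using * by linarith
qed

lemma cell_dist:
  assumes "z \<in> cell i" "w \<in> cell i"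
  shows "dist (snd w) (snd z) < fst c * fst z"
  using assms by (intro dist_ix) (auto simp: cell_def)

text \<open>Heights inside a cell differ by a factor of at most 3/2, strictly below
  \<open>snd c\<close>; this is where the threshold for Whitney parameters enters.\<close>

lemma cell_subset_whitney_region:
  assumes "z \<in> cell i"
  shows "cell i \<subseteq> whitney_region c z"
proof
  fix w assume w: "w \<in> cell i"
  note zb = cell_bounds[OF assms] and wb = cell_bounds[OF w]
  have "fst w < snd c * fst z"
  proof -
    have "fst w \<le> 3/2 * fst z" using zb wb by linarith
    also have "\<dots> < snd c * fst z" using zb c_pos by (intro mult_strict_right_mono) auto
    finally show ?thesis .
  qed
  moreover have "fst z / snd c < fst w"
  proof -
    have "fst z \<le> 3/2 * fst w" using zb wb by linarith
    also have "\<dots> < snd c * fst w" using wb c_pos by (intro mult_strict_right_mono) auto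
    finally show ?thesis using c_pos by (simp add: field_simps)
  qed
  ultimately show "w \<in> whitney_region c z"
    using cell_dist[OF assms w] by (simp add: whitney_region_def)
qed

lemma mem_nbhdI:
  assumes z: "fst z > 0" and w: "w \<in> cell i" "w \<in> whitney_region c z"
  shows "z \<in> nbhd i"
proof -
  let ?b = "base_point i"
  note b = cell_bounds[OF base_point_cell[of i]] and wb = cell_bounds[OF w(1)]
  have w': "fst z < snd c * fst w" "fst w < snd c * fst z" "dist (snd w) (snd z) < fst c * fst z"
    using w(2) c_pos by (auto simp: whitney_region_def field_simps)
  have "snd c * fst w \<le> snd c * (3/2 * fst ?b)" using b wb c_pos by (intro mult_left_mono) auto
  then have zb: "fst z < 2 * snd c * fst ?b" using w' b c_pos mult_pos_pos[of "snd c" "fst ?b"] by linarith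
  have "fst ?b \<le> 3/2 * fst w" using b wb by linarith
  also have "\<dots> < 3/2 * (snd c * fst z)" using w' by simp
  also have "\<dots> \<le> 2 * snd c * fst z" using z c_pos mult_pos_pos[of "snd c" "fst z"] by linarith
  finally have bz: "fst ?b < 2 * snd c * fst z" .
  have "dist (snd z) (snd ?b) \<le> dist (snd w) (snd z) + dist (snd w) (snd ?b)"
    by (metis dist_commute dist_triangle)
  also have "\<dots> < fst c * fst z + fst c * fst ?b"
    using w' cell_dist[OF base_point_cell w(1)] by linarith
  also have "\<dots> \<le> fst c * (2 * snd c * fst ?b) + fst c * fst ?b"
    using zb c_pos by simp
  also have "\<dots> = fst c * (1 + 2 * snd c) * fst ?b" by (simp add: algebra_simps)
  finally show ?thesis
    using zb bz c_pos by (simp add: nbhd_def whitney_region_def field_simps)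
qed

lemma nbhd_bounds:
  assumes "z \<in> nbhd i"
  shows "fst z > 0" "fst z \<le> \<Lambda> * T i" "T i \<le> \<Lambda> * fst z"
    "fst (base_point i) < 2 * snd c * fst z" "fst z < 2 * snd c * fst (base_point i)"
    "dist (snd z) (snd (base_point i)) < fst c * (1 + 2 * snd c) * fst (base_point i)"
proof -
  let ?b = "base_point i"
  note b = cell_bounds[OF base_point_cell[of i]]
  have *: "fst ?b / (2 * snd c) < fst z" and zb: "fst z < 2 * snd c * fst ?b"
    and d: "dist (snd z) (snd ?b) < fst c * (1 + 2 * snd c) * fst ?b"
    using assms by (auto simp: nbhd_def whitney_region_def)
  have "0 < fst ?b / (2 * snd c)" using b c_pos by simp
  then show z: "fst z > 0" using * by linarith
  show bz: "fst ?b < 2 * snd c * fst z" using * c_pos by (simp add: field_simps)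
  show "fst z < 2 * snd c * fst ?b" "dist (snd z) (snd ?b) < fst c * (1 + 2 * snd c) * fst ?b" by fact+
  have "2 * snd c * fst ?b \<le> 2 * snd c * (3/2 * T i)" using b c_pos by (intro mult_left_mono) auto
  then show "fst z \<le> \<Lambda> * T i" using zb by (simp add: \<Lambda>_def)
  show "T i \<le> \<Lambda> * fst z"
    using bz b z c_pos mult_pos_pos[of "snd c" "fst z"] by (simp add: \<Lambda>_def)
qed

text \<open>The neighbourhood relation read from \<open>z\<close>: all cells that see
  \<open>z\<close> fit into one region about \<open>z\<close>, as the packing argument requires. The
  vertical factor 3/2 * 2 * \<open>snd c\<close> is rounded up to 4 * \<open>snd c\<close>;
  horizontally the last factor 2 * \<open>snd c\<close> passes from the base height to the height of
  \<open>z\<close>.\<close>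

lemma cell_subset_wide_region:
  assumes "z \<in> nbhd i"
  shows "cell i \<subseteq> whitney_region (fst c * (2 + 2 * snd c) * (2 * snd c), 4 * snd c) z"
proof
  fix w assume w: "w \<in> cell i"
  let ?b = "base_point i"
  note b = cell_bounds[OF base_point_cell[of i]] and wb = cell_bounds[OF w] and zb = nbhd_bounds[OF assms]
  have p: "0 < snd c * fst z" "0 < snd c * fst w" using zb wb c_pos by auto
  have 1: "fst w < 4 * snd c * fst z" using b wb zb p by linarith
  have "fst ?b \<le> 3/2 * fst w" using b wb by linarith
  then have "2 * snd c * fst ?b \<le> 2 * snd c * (3/2 * fst w)" using c_pos by (intro mult_left_mono) auto
  then have 2: "fst z < 4 * snd c * fst w" using zb p by linarith
  have "dist (snd w) (snd z) \<le> dist (snd w) (snd ?b) + dist (snd z) (snd ?b)"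
    by (rule dist_triangle2)
  also have "\<dots> < fst c * fst ?b + fst c * (1 + 2 * snd c) * fst ?b"
    using zb cell_dist[OF base_point_cell w] by linarith
  also have "\<dots> = fst c * (2 + 2 * snd c) * fst ?b" by (simp add: algebra_simps)
  also have "\<dots> \<le> fst c * (2 + 2 * snd c) * (2 * snd c * fst z)"
    using zb c_pos by (intro mult_left_mono) auto
  finally have "dist (snd w) (snd z) < fst c * (2 + 2 * snd c) * (2 * snd c) * fst z" by (simp add: algebra_simps)
  then show "w \<in> whitney_region (fst c * (2 + 2 * snd c) * (2 * snd c), 4 * snd c) z"
    using 1 2 c_pos by (simp add: whitney_region_def field_simps)
qed

definition overlap_bound :: real where
  "overlap_bound = whitney_vol D (fst c * (2 + 2 * snd c) * (2 * snd c), 4 * snd c) * \<Lambda> powr (N + 1) / v"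

lemma overlap_bound_pos: "overlap_bound > 0"
  unfolding overlap_bound_def using \<Lambda>_pos v_pos c_pos
  by (intro divide_pos_pos mult_pos_pos whitney_vol_pos) auto

text \<open>A packing argument: the cells that are counted are disjoint, lie in one wide region
  about \<open>z\<close>, and each fills a fixed fraction of its volume. The bound is the reciprocal
  of that fraction.\<close>

lemma bounded_overlap:
  assumes z: "fst z > 0"
  shows "(\<Sum>i. indicator (nbhd i) z) \<le> ennreal overlap_bound"
proof -
  let ?c = "(fst c * (2 + 2 * snd c) * (2 * snd c), 4 * snd c)"
  let ?W = "whitney_region ?c z"
  \<comment> \<open>A lower bound, in terms of the height of \<open>z\<close>, for the volume of any
    cell whose neighbourhood contains \<open>z\<close>.\<close>
  define k where "k = v * \<Lambda> powr (-(N + 1)) * fst z powr (N + 1)"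
  have k: "k > 0" unfolding k_def using v_pos \<Lambda>_pos z by simp
  have W[measurable]: "?W \<in> sets lebesgue" using whitney_region_sets by simp
  have "ennreal k * (\<Sum>i. indicator (nbhd i) z) = (\<Sum>i. ennreal k * indicator (nbhd i) z)" by simp
  also have "\<dots> \<le> (\<Sum>i. emeasure lebesgue (cell i \<inter> ?W))"
  proof (intro suminf_le summableI)
    fix i
    show "ennreal k * indicator (nbhd i) z \<le> emeasure lebesgue (cell i \<inter> ?W)"
    proof (cases "z \<in> nbhd i")
      case True
      note zb = nbhd_bounds[OF True]
      have "fst z powr (N + 1) \<le> \<Lambda> powr \<bar>N + 1\<bar> * T i powr (N + 1)"
        using zb T_pos[of i] by (intro powr_comparable) auto
      then have "\<Lambda> powr (-(N + 1)) * fst z powr (N + 1) \<le> \<Lambda> powr (-(N + 1)) * (\<Lambda> powr (N + 1) * T i powr (N + 1))"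
        by (intro mult_left_mono) auto
      then have "\<Lambda> powr (-(N + 1)) * fst z powr (N + 1) \<le> T i powr (N + 1)"
        using \<Lambda>_pos by (simp add: mult.assoc[symmetric] flip: powr_add)
      then have "k \<le> v * T i powr (N + 1)"
        unfolding k_def using v_pos by (simp add: mult.assoc)
      then have "ennreal k \<le> ennreal (v * T i powr (N + 1))" by (rule ennreal_leI)
      also have "\<dots> \<le> emeasure lebesgue (cell i)" using cell_vol[of i] by (simp add: cell_def)
      also have "cell i = cell i \<inter> ?W" using cell_subset_wide_region[OF True] by blast
      finally show ?thesis using True by simp
    qed simp
  qed
  also have "\<dots> = emeasure lebesgue (\<Union>i. cell i \<inter> ?W)"
    using disjoint_cell by (intro suminf_emeasure) (auto simp: disjoint_family_on_def)
  also have "\<dots> \<le> emeasure lebesgue ?W"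
    by (intro emeasure_mono) auto
  also have "\<dots> = ennreal (whitney_vol D ?c * fst z powr (N + 1))"
    using c_pos z by (intro emeasure_region) auto
  also have "\<dots> = ennreal (k * overlap_bound)"
    using v_pos \<Lambda>_pos by (intro arg_cong[of _ _ ennreal]) (simp add: k_def overlap_bound_def flip: powr_add)
  also have "\<dots> = ennreal k * ennreal overlap_bound" using k overlap_bound_pos by (intro ennreal_mult) auto
  finally show ?thesis using k by (subst (asm) ennreal_mult_le_mult_iff) auto
qed

section \<open>Local masses and their comparison with Whitney averages\<close>

definition mass :: "nat \<Rightarrow> (real \<times> (real^'n) \<Rightarrow> complex^'m) \<Rightarrow> ennreal" where
  "mass i f = (\<integral>\<^sup>+w\<in>cell i. ennreal ((norm (f w))\<^sup>2) \<partial>lebesgue)"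

text \<open>Up to constants the mean of the squared norm of \<open>kappa a f\<close> over the cell:
  the exponent \<open>2 * a\<close> comes from \<open>kappa\<close>, and \<open>-(N + 1)\<close>
  from the volume of a cell.\<close>

definition dens :: "real \<Rightarrow> nat \<Rightarrow> (real \<times> (real^'n) \<Rightarrow> complex^'m) \<Rightarrow> ennreal" where
  "dens a i f = ennreal (T i powr (2 * a - (N + 1))) * mass i f"

definition sq_avg :: "real \<Rightarrow> (real \<times> (real^'n) \<Rightarrow> complex^'m) \<Rightarrow> real \<times> (real^'n) \<Rightarrow> ennreal" where
  "sq_avg a f z = (\<integral>\<^sup>+w\<in>whitney_region c z. ennreal ((norm (kappa a f w))\<^sup>2) \<partial>lebesgue)
     / emeasure lebesgue (whitney_region c z)"

lemma whitney_avg_eq: "whitney_avg c (kappa a f) z = enn_rpow (sq_avg a f z) (1/2)"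
  by (simp add: whitney_avg_def sq_avg_def)

text \<open>One constant for both comparisons. The powers of \<open>\<Lambda>\<close> freeze the
  weight and the volume at the scale of the cell; the maximum covers multiplication by the
  normalised volume in one direction and division by it in the other.\<close>

definition C_avg :: "real \<Rightarrow> real" where
  "C_avg a = \<Lambda> powr \<bar>2 * a\<bar> * \<Lambda> powr (N + 1) * max (whitney_vol D c) (1 / whitney_vol D c)"

lemma vol_pos: "whitney_vol D c > 0"
  using c_pos by (intro whitney_vol_pos) auto

lemma C_avg_pos: "C_avg a > 0"
  unfolding C_avg_def using vol_pos \<Lambda>_pos by (intro mult_pos_pos) (auto simp: less_max_iff_disj)

lemma norm_kappa_sq: "fst w > 0 \<Longrightarrow> (norm (kappa a f w))\<^sup>2 = fst w powr (2 * a) * (norm (f w))\<^sup>2"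
  by (simp add: kappa_def power_mult_distrib powr_powr mult.commute flip: powr_realpow)

lemma measurable_kappa [measurable]:
  "f \<in> borel_measurable lebesgue \<Longrightarrow> kappa a f \<in> borel_measurable lebesgue"
  unfolding kappa_def[abs_def] by measurable

lemma dens_le_sq_avg:
  assumes f [measurable]: "f \<in> borel_measurable lebesgue" and z: "z \<in> cell i"
  shows "dens a i f \<le> ennreal (C_avg a) * sq_avg a f z"
proof -
  let ?V = "whitney_vol D c * fst z powr (N + 1)"
  let ?I = "\<integral>\<^sup>+w\<in>whitney_region c z. ennreal ((norm (kappa a f w))\<^sup>2) \<partial>lebesgue"
  note zb = cell_bounds[OF z]
  have W[measurable]: "whitney_region c z \<in> sets lebesgue" using whitney_region_sets by simp
  have V: "emeasure lebesgue (whitney_region c z) = ennreal ?V" "?V > 0"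
    using zb c_pos vol_pos by (auto intro!: emeasure_region simp del: emeasure_completion)
  have avg: "sq_avg a f z * ennreal ?V = ?I"
  proof -
    have "ennreal ?V \<noteq> 0" using V(2) by (metis ennreal_eq_0_iff not_le)
    then have "?I * ennreal ?V / ennreal ?V = ?I" by (intro mult_divide_eq_ennreal) auto
    then show ?thesis unfolding sq_avg_def V(1) by (simp only: ennreal_divide_times ennreal_times_divide)
  qed
  have "mass i f \<le> (\<integral>\<^sup>+w. ennreal (\<Lambda> powr \<bar>2 * a\<bar> * T i powr (- 2 * a)) *
      (ennreal ((norm (kappa a f w))\<^sup>2) * indicator (whitney_region c z) w) \<partial>lebesgue)"
    unfolding mass_def
  proof (intro nn_integral_mono)
    fix w
    show "ennreal ((norm (f w))\<^sup>2) * indicator (cell i) w \<le> ennreal (\<Lambda> powr \<bar>2 * a\<bar> * T i powr (- 2 * a)) *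
      (ennreal ((norm (kappa a f w))\<^sup>2) * indicator (whitney_region c z) w)"
    proof (cases "w \<in> cell i")
      case True
      note wb = cell_bounds[OF True]
      have "(norm (f w))\<^sup>2 = fst w powr (- 2 * a) * (norm (kappa a f w))\<^sup>2"
        using wb by (simp add: norm_kappa_sq powr_minus)
      also have "\<dots> \<le> (\<Lambda> powr \<bar>- 2 * a\<bar> * T i powr (- 2 * a)) * (norm (kappa a f w))\<^sup>2"
        using wb T_pos[of i] by (intro mult_right_mono powr_comparable) auto
      finally have "(norm (f w))\<^sup>2 \<le> (\<Lambda> powr \<bar>2 * a\<bar> * T i powr (- 2 * a)) * (norm (kappa a f w))\<^sup>2" by simp
      then show ?thesis
        using True cell_subset_whitney_region[OF z] by (auto simp: ennreal_leI simp flip: ennreal_mult)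
    qed simp
  qed
  also have "\<dots> = ennreal (\<Lambda> powr \<bar>2 * a\<bar> * T i powr (- 2 * a)) * ?I"
    by (intro nn_integral_cmult) measurable
  also have "\<dots> = ennreal (\<Lambda> powr \<bar>2 * a\<bar> * T i powr (- 2 * a) * ?V) * sq_avg a f z"
  proof -
    have "ennreal (\<Lambda> powr \<bar>2 * a\<bar> * T i powr (- 2 * a) * ?V) = ennreal (\<Lambda> powr \<bar>2 * a\<bar> * T i powr (- 2 * a)) * ennreal ?V"
      using V(2) by (intro ennreal_mult) auto
    then show ?thesis unfolding avg[symmetric] by (simp only: mult_ac)
  qed
  finally have "dens a i f \<le> ennreal (T i powr (2 * a - (N + 1))) * (ennreal (\<Lambda> powr \<bar>2 * a\<bar> * T i powr (- 2 * a) * ?V) * sq_avg a f z)"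
    unfolding dens_def by (intro mult_left_mono) auto
  also have "\<dots> = ennreal (T i powr (2 * a - (N + 1)) * (\<Lambda> powr \<bar>2 * a\<bar> * T i powr (- 2 * a) * ?V)) * sq_avg a f z"
    using V(2) by (simp add: ennreal_mult' mult.assoc)
  also have "\<dots> \<le> ennreal (C_avg a) * sq_avg a f z"
  proof (intro mult_right_mono ennreal_leI)
    have "fst z powr (N + 1) \<le> \<Lambda> powr \<bar>N + 1\<bar> * T i powr (N + 1)"
      using zb T_pos[of i] by (intro powr_comparable) auto
    then have "?V \<le> max (whitney_vol D c) (1 / whitney_vol D c) * (\<Lambda> powr (N + 1) * T i powr (N + 1))"
      using vol_pos by (intro mult_mono) auto
    then have "T i powr (2 * a - (N + 1)) * (\<Lambda> powr \<bar>2 * a\<bar> * T i powr (- 2 * a) * ?V) \<le>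
      T i powr (2 * a - (N + 1)) * (\<Lambda> powr \<bar>2 * a\<bar> * T i powr (- 2 * a) *
        (max (whitney_vol D c) (1 / whitney_vol D c) * (\<Lambda> powr (N + 1) * T i powr (N + 1))))"
      by (intro mult_left_mono) auto
    also have "\<dots> = C_avg a * (T i powr (2 * a - (N + 1)) * T i powr (- 2 * a) * T i powr (N + 1))"
      unfolding C_avg_def by (simp add: mult_ac)
    also have "T i powr (2 * a - (N + 1)) * T i powr (- 2 * a) * T i powr (N + 1) = 1"
      using T_pos[of i] by (simp flip: powr_add)
    finally show "T i powr (2 * a - (N + 1)) * (\<Lambda> powr \<bar>2 * a\<bar> * T i powr (- 2 * a) * ?V) \<le> C_avg a" by simp
  qed auto
  finally show ?thesis .
qed

text \<open>Each point of the region lies in exactly one cell, and \<open>z\<close> belongs to the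
  neighbourhood of that cell. Splitting the integral over cells therefore leaves only indices
  visible through \<open>nbhd\<close>.\<close>

lemma sq_avg_le:
  assumes f [measurable]: "f \<in> borel_measurable lebesgue" and z: "fst z > 0"
  shows "sq_avg a f z \<le> ennreal (C_avg a) * (\<Sum>i. indicator (nbhd i) z * dens a i f)"
proof -
  let ?V = "whitney_vol D c * fst z powr (N + 1)"
  let ?k = "\<lambda>i. indicator (nbhd i) z * ennreal (\<Lambda> powr \<bar>2 * a\<bar> * T i powr (2 * a))"
  have V: "emeasure lebesgue (whitney_region c z) = ennreal ?V" "?V > 0"
    using z c_pos vol_pos by (auto intro!: emeasure_region simp del: emeasure_completion)
  have "(\<integral>\<^sup>+w\<in>whitney_region c z. ennreal ((norm (kappa a f w))\<^sup>2) \<partial>lebesgue) \<le>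
    (\<integral>\<^sup>+w. (\<Sum>i. ?k i * (ennreal ((norm (f w))\<^sup>2) * indicator (cell i) w)) \<partial>lebesgue)"
  proof (intro nn_integral_mono)
    fix w
    let ?F = "\<lambda>i. ?k i * (ennreal ((norm (f w))\<^sup>2) * indicator (cell i) w)"
    show "ennreal ((norm (kappa a f w))\<^sup>2) * indicator (whitney_region c z) w \<le> suminf ?F"
    proof (cases "w \<in> whitney_region c z")
      case True
      then have "fst z / snd c < fst w" by (simp add: whitney_region_def)
      then have "0 < fst w" using divide_pos_pos[OF z c_pos(4)] by linarith
      then have w: "w \<in> cell (ix w)" by (rule cell_ix)
      note wb = cell_bounds[OF w]
      have "(norm (kappa a f w))\<^sup>2 \<le> (\<Lambda> powr \<bar>2 * a\<bar> * T (ix w) powr (2 * a)) * (norm (f w))\<^sup>2"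
        unfolding norm_kappa_sq[OF wb(1)] using wb T_pos[of "ix w"]
        by (intro mult_right_mono powr_comparable) auto
      then have "ennreal ((norm (kappa a f w))\<^sup>2) * indicator (whitney_region c z) w \<le> sum ?F {ix w}"
        using True w mem_nbhdI[OF z w True] by (auto simp: ennreal_leI simp flip: ennreal_mult)
      also have "\<dots> \<le> suminf ?F" by (intro sum_le_suminf summableI) auto
      finally show ?thesis .
    qed simp
  qed
  also have "\<dots> = (\<Sum>i. \<integral>\<^sup>+w. ?k i * (ennreal ((norm (f w))\<^sup>2) * indicator (cell i) w) \<partial>lebesgue)"
    by (intro nn_integral_suminf) measurable
  also have "\<dots> = (\<Sum>i. ?k i * mass i f)"
    unfolding mass_def by (intro suminf_cong nn_integral_cmult) measurable
  finally have "sq_avg a f z \<le> (\<Sum>i. ?k i * mass i f) / ennreal ?V"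
    unfolding sq_avg_def V(1) by (rule divide_right_mono_ennreal)
  also have "\<dots> = (\<Sum>i. ?k i * mass i f / ennreal ?V)" by simp
  also have "\<dots> \<le> (\<Sum>i. ennreal (C_avg a) * (indicator (nbhd i) z * dens a i f))"
  proof (intro suminf_le summableI)
    fix i
    show "?k i * mass i f / ennreal ?V \<le> ennreal (C_avg a) * (indicator (nbhd i) z * dens a i f)"
    proof (cases "z \<in> nbhd i")
      case True
      note zb = nbhd_bounds[OF True]
      have "?k i * mass i f / ennreal ?V = ennreal (\<Lambda> powr \<bar>2 * a\<bar> * T i powr (2 * a) / ?V) * mass i f"
      proof -
        have "?k i * mass i f / ennreal ?V = (ennreal (\<Lambda> powr \<bar>2 * a\<bar> * T i powr (2 * a)) / ennreal ?V) * mass i f"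
          using True by (simp add: divide_ennreal_def mult_ac)
        then show ?thesis using V(2) by (simp only: divide_ennreal[OF _ V(2)] mult_nonneg_nonneg powr_ge_zero)
      qed
      also have "\<dots> \<le> ennreal (C_avg a * T i powr (2 * a - (N + 1))) * mass i f"
      proof (intro mult_right_mono ennreal_leI)
        have "fst z powr (-(N + 1)) \<le> \<Lambda> powr \<bar>-(N + 1)\<bar> * T i powr (-(N + 1))"
          using zb T_pos[of i] by (intro powr_comparable) auto
        moreover have "\<bar>-(N + 1)\<bar> = N + 1" by simp
        ultimately have "fst z powr (-(N + 1)) \<le> \<Lambda> powr (N + 1) * T i powr (-(N + 1))" by (simp only:)
        then have "1 / whitney_vol D c * fst z powr (-(N + 1)) \<le>
           max (whitney_vol D c) (1 / whitney_vol D c) * (\<Lambda> powr (N + 1) * T i powr (-(N + 1)))"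
          using vol_pos by (intro mult_mono) auto
        then have "\<Lambda> powr \<bar>2 * a\<bar> * T i powr (2 * a) * (1 / whitney_vol D c * fst z powr (-(N + 1))) \<le>
          \<Lambda> powr \<bar>2 * a\<bar> * T i powr (2 * a) *
           (max (whitney_vol D c) (1 / whitney_vol D c) * (\<Lambda> powr (N + 1) * T i powr (-(N + 1))))"
          by (intro mult_left_mono) auto
        also have "\<dots> = C_avg a * (T i powr (2 * a) * T i powr (-(N + 1)))"
          unfolding C_avg_def by (simp add: mult_ac)
        also have "T i powr (2 * a) * T i powr (-(N + 1)) = T i powr (2 * a - (N + 1))"
          using powr_add[of "T i" "2 * a" "-(N + 1)"] by (simp only: diff_conv_add_uminus)
        finally show "\<Lambda> powr \<bar>2 * a\<bar> * T i powr (2 * a) / ?V \<le> C_avg a * T i powr (2 * a - (N + 1))"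
          by (simp only: powr_minus divide_inverse inverse_mult_distrib mult_1_left mult_ac)
      qed auto
      also have "\<dots> = ennreal (C_avg a) * (indicator (nbhd i) z * dens a i f)"
        using True C_avg_pos[of a] by (simp add: dens_def ennreal_mult' mult_ac)
      finally show ?thesis .
    qed simp
  qed
  also have "\<dots> = ennreal (C_avg a) * (\<Sum>i. indicator (nbhd i) z * dens a i f)" by simp
  finally show ?thesis .
qed

end

section \<open>Discrete quasinorms\<close>

context whitney_cover
begin

lemma half_measure_cell:
  "ennreal (v * (2/3) * T i powr N) \<le> emeasure half_measure (cell i)"
proof -
  have "ennreal (v * (2/3) * T i powr N) = ennreal (2 / (3 * T i)) * ennreal (v * T i powr (N + 1))"
    using T_pos[of i] v_pos by (simp add: powr_add flip: ennreal_mult)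
  also have "\<dots> \<le> ennreal (2 / (3 * T i)) * emeasure lebesgue (cell i)"
    using cell_vol[of i, folded cell_def] by (intro mult_left_mono) auto
  also have "\<dots> = (\<integral>\<^sup>+z. ennreal (2 / (3 * T i)) * indicator (cell i) z \<partial>lebesgue)"
    by (subst nn_integral_cmult_indicator) auto
  also have "\<dots> \<le> (\<integral>\<^sup>+z. (indicator upper_half z * ennreal (1 / fst z)) * indicator (cell i) z \<partial>lebesgue)"
  proof (intro nn_integral_mono)
    fix z
    show "ennreal (2 / (3 * T i)) * indicator (cell i) z \<le> (indicator upper_half z * ennreal (1 / fst z)) * indicator (cell i) z"
    proof (cases "z \<in> cell i")
      case True
      note zb = cell_bounds[OF True]
      have "2 / (3 * T i) \<le> 1 / fst z" using zb T_pos[of i] by (simp add: field_simps)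
      then show ?thesis using True zb by (simp add: upper_half_def ennreal_leI)
    qed simp
  qed
  also have "\<dots> = emeasure half_measure (cell i)"
    unfolding half_measure_def by (rule emeasure_density[symmetric]) auto
  finally show ?thesis .
qed

lemma half_measure_cell_pos: "emeasure half_measure (cell i) > 0"
proof -
  have "0 < v * (2/3) * T i powr N" using v_pos T_pos[of i] by simp
  then have "0 < ennreal (v * (2/3) * T i powr N)" by simp
  then show ?thesis using half_measure_cell by (rule less_le_trans)
qed

text \<open>Of the \<open>N + 2\<close> powers of \<open>\<Lambda>\<close>, \<open>N + 1\<close>
  come from the volume at the base height and one from the density 1/t.\<close>

definition C_nbhd :: real where
  "C_nbhd = whitney_vol D (fst c * (1 + 2 * snd c), 2 * snd c) * \<Lambda> powr (N + 2)"

lemma C_nbhd_pos: "C_nbhd > 0"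
  unfolding C_nbhd_def using c_pos \<Lambda>_pos by (intro mult_pos_pos whitney_vol_pos) auto

lemma half_measure_nbhd: "emeasure half_measure (nbhd i) \<le> ennreal (C_nbhd * T i powr N)"
proof -
  let ?b = "base_point i"
  let ?v = "whitney_vol D (fst c * (1 + 2 * snd c), 2 * snd c)"
  note b = cell_bounds[OF base_point_cell[of i]]
  have "emeasure half_measure (nbhd i) = (\<integral>\<^sup>+z. (indicator upper_half z * ennreal (1 / fst z)) * indicator (nbhd i) z \<partial>lebesgue)"
    unfolding half_measure_def by (rule emeasure_density) auto
  also have "\<dots> \<le> (\<integral>\<^sup>+z. ennreal (\<Lambda> / T i) * indicator (nbhd i) z \<partial>lebesgue)"
  proof (intro nn_integral_mono)
    fix z
    show "(indicator upper_half z * ennreal (1 / fst z)) * indicator (nbhd i) z \<le> ennreal (\<Lambda> / T i) * indicator (nbhd i) z"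
    proof (cases "z \<in> nbhd i")
      case True
      note zb = nbhd_bounds[OF True]
      have "1 / fst z \<le> \<Lambda> / T i" using zb T_pos[of i] by (simp add: field_simps)
      then show ?thesis using True zb by (simp add: upper_half_def ennreal_leI)
    qed simp
  qed
  also have "\<dots> = ennreal (\<Lambda> / T i) * emeasure lebesgue (nbhd i)"
    by (subst nn_integral_cmult_indicator) auto
  also have "emeasure lebesgue (nbhd i) = ennreal (?v * fst ?b powr (N + 1))"
    unfolding nbhd_def using c_pos b by (intro emeasure_region) auto
  also have "ennreal (\<Lambda> / T i) * \<dots> \<le> ennreal (\<Lambda> / T i) * ennreal (?v * (\<Lambda> powr (N + 1) * T i powr (N + 1)))"
  proof (intro mult_left_mono ennreal_leI)
    have "fst ?b powr (N + 1) \<le> \<Lambda> powr \<bar>N + 1\<bar> * T i powr (N + 1)"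
      using b T_pos[of i] by (intro powr_comparable) auto
    then show "fst ?b powr (N + 1) \<le> \<Lambda> powr (N + 1) * T i powr (N + 1)" by simp
    show "0 \<le> ?v" using c_pos by (intro less_imp_le whitney_vol_pos) auto
  qed auto
  also have "\<dots> = ennreal (C_nbhd * T i powr N)"
  proof -
    have "0 \<le> ?v" using c_pos by (intro less_imp_le whitney_vol_pos) auto
    moreover have "\<Lambda> / T i * (?v * (\<Lambda> powr (N + 1) * T i powr (N + 1))) = C_nbhd * T i powr N"
    proof -
      have "\<Lambda> powr (N + 2) = \<Lambda> powr (N + 1) * \<Lambda> powr 1" unfolding powr_add[symmetric] by (simp add: add.assoc)
      then have eq: "\<Lambda> powr (N + 2) = \<Lambda> powr (N + 1) * \<Lambda>" using \<Lambda>_pos by simp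
      show ?thesis unfolding C_nbhd_def eq using T_pos[of i] by (simp add: powr_add)
    qed
    ultimately show ?thesis using \<Lambda>_pos T_pos[of i] by (simp flip: ennreal_mult)
  qed
  finally show ?thesis .
qed

text \<open>Comparing with this sum, in both directions, never requires measurability of the Whitney average.\<close>

definition discrete_sum :: "real \<Rightarrow> real \<Rightarrow> (real \<times> (real^'n) \<Rightarrow> complex^'m) \<Rightarrow> ennreal" where
  "discrete_sum p s f = (\<Sum>i. ennreal (T i powr N) * enn_rpow (dens (-s) i f) (p/2))"

lemma Z_fin_rpow:
  assumes "0 < p"
  shows "enn_rpow (Z_fin p s c f) p = (\<integral>\<^sup>+z. enn_rpow (sq_avg (-s) f z) (p/2) \<partial>half_measure)"
  using assms by (simp add: Z_fin_def enn_rpow_rpow whitney_avg_eq)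

text \<open>By disjointness of the cells, a step function that is a multiple of the density power on
  each cell lies below the integrand of the quasinorm. The factor \<open>3 / (2 * v)\<close> inverts
  the lower bound for \<open>half_measure\<close> of a cell.\<close>

lemma discrete_sum_le_Z_fin:
  assumes p: "0 < p" and f: "f \<in> borel_measurable lebesgue"
  shows "discrete_sum p s f \<le> ennreal (C_avg (-s) powr (p/2) * (3 / (2 * v))) * enn_rpow (Z_fin p s c f) p"
proof -
  let ?A = "C_avg (-s) powr (p/2)"
  let ?d = "\<lambda>i. enn_rpow (dens (-s) i f) (p/2)"
  have A: "?A > 0" using C_avg_pos[of "-s"] by simp
  have "ennreal (v * (2/3) / ?A) * discrete_sum p s f = (\<Sum>i. ennreal (1 / ?A) * ?d i * ennreal (v * (2/3) * T i powr N))"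
    unfolding discrete_sum_def ennreal_suminf_cmult[symmetric]
  proof (rule suminf_cong)
    fix i
    have "ennreal (v * (2/3) / ?A) = ennreal (1 / ?A) * ennreal (v * (2/3))"
      using v_pos A by (simp flip: ennreal_mult)
    moreover have "ennreal (v * (2/3) * T i powr N) = ennreal (v * (2/3)) * ennreal (T i powr N)"
      using v_pos by (intro ennreal_mult) auto
    ultimately show "ennreal (v * (2/3) / ?A) * (ennreal (T i powr N) * ?d i) = ennreal (1 / ?A) * ?d i * ennreal (v * (2/3) * T i powr N)"
      by (simp add: mult_ac)
  qed
  also have "\<dots> \<le> (\<Sum>i. ennreal (1 / ?A) * ?d i * emeasure half_measure (cell i))"
    by (intro suminf_le summableI mult_left_mono half_measure_cell) auto
  also have "\<dots> = (\<Sum>i. \<integral>\<^sup>+z. ennreal (1 / ?A) * ?d i * indicator (cell i) z \<partial>half_measure)"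
    by (intro suminf_cong nn_integral_cmult_indicator[symmetric]) (simp add: sets_half_measure)
  also have "\<dots> = (\<integral>\<^sup>+z. (\<Sum>i. ennreal (1 / ?A) * ?d i * indicator (cell i) z) \<partial>half_measure)"
    by (intro nn_integral_suminf[symmetric]) (simp add: sets_half_measure)
  also have "\<dots> \<le> (\<integral>\<^sup>+z. enn_rpow (sq_avg (-s) f z) (p/2) \<partial>half_measure)"
  proof (rule nn_integral_mono_AE, use AE_half_measure_pos in eventually_elim)
    case (elim z)
    have z: "z \<in> cell (ix z)" using elim by (rule cell_ix)
    have "(\<Sum>i. ennreal (1 / ?A) * ?d i * indicator (cell i) z) = ennreal (1 / ?A) * ?d (ix z)"
      by (rule suminf_cmult_indicator[OF disjoint_cell z])
    also have "\<dots> \<le> ennreal (1 / ?A) * enn_rpow (ennreal (C_avg (-s)) * sq_avg (-s) f z) (p/2)"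
      using p dens_le_sq_avg[OF f z, of "-s"] by (intro mult_left_mono enn_rpow_mono) auto
    also have "\<dots> = ennreal (1 / ?A) * ennreal ?A * enn_rpow (sq_avg (-s) f z) (p/2)"
      using p C_avg_pos[of "-s"] by (simp add: enn_rpow_mult enn_rpow_ennreal mult.assoc)
    also have "ennreal (1 / ?A) * ennreal ?A = 1"
      using A by (simp flip: ennreal_mult)
    finally show ?case by simp
  qed
  also have "\<dots> = enn_rpow (Z_fin p s c f) p" using p by (simp add: Z_fin_rpow)
  finally have *: "ennreal (v * (2/3) / ?A) * discrete_sum p s f \<le> enn_rpow (Z_fin p s c f) p" .
  have "ennreal (?A * (3 / (2 * v))) * ennreal (v * (2/3) / ?A) = 1"
    using A v_pos by (simp flip: ennreal_mult)
  then have "discrete_sum p s f = ennreal (?A * (3 / (2 * v))) * (ennreal (v * (2/3) / ?A) * discrete_sum p s f)"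
    by (simp add: mult.assoc[symmetric])
  also have "\<dots> \<le> ennreal (?A * (3 / (2 * v))) * enn_rpow (Z_fin p s c f) p"
    using * by (intro mult_left_mono) auto
  finally show ?thesis .
qed

text \<open>Since p/2 \<le> 1, the power may be distributed over the sum of neighbouring densities;
  each term then integrates to the measure of one neighbourhood, which is of order T^N.\<close>

lemma Z_fin_le_discrete_sum:
  assumes p: "0 < p" "p \<le> 1" and f: "f \<in> borel_measurable lebesgue"
  shows "enn_rpow (Z_fin p s c f) p \<le> ennreal (C_avg (-s) powr (p/2) * C_nbhd) * discrete_sum p s f"
proof -
  let ?A = "C_avg (-s) powr (p/2)"
  let ?d = "\<lambda>i. enn_rpow (dens (-s) i f) (p/2)"
  have "enn_rpow (Z_fin p s c f) p = (\<integral>\<^sup>+z. enn_rpow (sq_avg (-s) f z) (p/2) \<partial>half_measure)"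
    using p by (simp add: Z_fin_rpow)
  also have "\<dots> \<le> (\<integral>\<^sup>+z. (\<Sum>i. ennreal ?A * ?d i * indicator (nbhd i) z) \<partial>half_measure)"
  proof (rule nn_integral_mono_AE, use AE_half_measure_pos in eventually_elim)
    case (elim z)
    have "enn_rpow (sq_avg (-s) f z) (p/2) \<le> enn_rpow (ennreal (C_avg (-s)) * (\<Sum>i. indicator (nbhd i) z * dens (-s) i f)) (p/2)"
      using p sq_avg_le[OF f elim] by (intro enn_rpow_mono) auto
    also have "\<dots> = ennreal ?A * enn_rpow (\<Sum>i. indicator (nbhd i) z * dens (-s) i f) (p/2)"
      using p C_avg_pos[of "-s"] by (simp add: enn_rpow_mult enn_rpow_ennreal)
    also have "\<dots> \<le> ennreal ?A * (\<Sum>i. enn_rpow (indicator (nbhd i) z * dens (-s) i f) (p/2))"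
      using p by (intro mult_left_mono enn_rpow_suminf_le) auto
    also have "\<dots> = (\<Sum>i. ennreal ?A * ?d i * indicator (nbhd i) z)"
      unfolding ennreal_suminf_cmult[symmetric] by (intro suminf_cong) (auto simp: indicator_def)
    finally show ?case .
  qed
  also have "\<dots> = (\<Sum>i. \<integral>\<^sup>+z. ennreal ?A * ?d i * indicator (nbhd i) z \<partial>half_measure)"
    by (intro nn_integral_suminf) (simp add: sets_half_measure)
  also have "\<dots> = (\<Sum>i. ennreal ?A * ?d i * emeasure half_measure (nbhd i))"
    by (intro suminf_cong nn_integral_cmult_indicator) (simp add: sets_half_measure)
  also have "\<dots> \<le> (\<Sum>i. ennreal ?A * ?d i * ennreal (C_nbhd * T i powr N))"
    by (intro suminf_le summableI mult_left_mono half_measure_nbhd) auto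
  also have "\<dots> = ennreal (?A * C_nbhd) * discrete_sum p s f"
    unfolding discrete_sum_def ennreal_suminf_cmult[symmetric]
    using C_nbhd_pos by (intro suminf_cong) (simp add: ennreal_mult mult_ac)
  finally show ?thesis .
qed

text \<open>A cell has positive measure, so the essential bound holds at some point of it, and the
  average at a single point of the cell already dominates the density.\<close>

lemma dens_le_Z_inf:
  assumes f: "f \<in> borel_measurable lebesgue"
  shows "dens (-(a + \<beta>)) i f \<le> ennreal (C_avg (-(a + \<beta>))) * enn_rpow (Z_inf a \<beta> c f) 2"
proof -
  have "AE z in half_measure. whitney_avg c (kappa (-(a + \<beta>)) f) z \<le> Z_inf a \<beta> c f"
    unfolding Z_inf_def by (rule AE_le_essential_Inf)
  moreover have "\<not> (AE z in half_measure. z \<notin> cell i)"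
    using half_measure_cell_pos[of i] by (subst AE_iff_measurable[of "cell i"]) (auto simp: sets_half_measure)
  ultimately obtain z where z: "z \<in> cell i" "whitney_avg c (kappa (-(a + \<beta>)) f) z \<le> Z_inf a \<beta> c f"
    by (metis (mono_tags, lifting) eventually_mono)
  then have "sq_avg (-(a + \<beta>)) f z \<le> enn_rpow (Z_inf a \<beta> c f) 2"
    by (simp add: whitney_avg_eq enn_rpow_le_iff)
  then have "ennreal (C_avg (-(a + \<beta>))) * sq_avg (-(a + \<beta>)) f z \<le> ennreal (C_avg (-(a + \<beta>))) * enn_rpow (Z_inf a \<beta> c f) 2"
    by (intro mult_left_mono) auto
  with dens_le_sq_avg[OF f z(1)] show ?thesis by (rule order_trans)
qed

text \<open>With a uniform bound \<open>d\<close> on the terms, the number of neighbours matters;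
  this is where \<open>bounded_overlap\<close> enters.\<close>

lemma Z_inf_le:
  assumes f: "f \<in> borel_measurable lebesgue" and d: "\<And>i. dens (-(a + \<beta>)) i f \<le> d"
  shows "Z_inf a \<beta> c f \<le> enn_rpow (ennreal (C_avg (-(a + \<beta>)) * overlap_bound) * d) (1/2)"
  unfolding Z_inf_def
proof (intro Inf_lower CollectI, use AE_half_measure_pos in eventually_elim)
  case (elim z)
  have "sq_avg (-(a + \<beta>)) f z \<le> ennreal (C_avg (-(a + \<beta>))) * (\<Sum>i. indicator (nbhd i) z * dens (-(a + \<beta>)) i f)"
    by (rule sq_avg_le[OF f elim])
  also have "\<dots> \<le> ennreal (C_avg (-(a + \<beta>))) * (\<Sum>i. indicator (nbhd i) z * d)"
    using d by (intro mult_left_mono suminf_le summableI) auto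
  also have "\<dots> \<le> ennreal (C_avg (-(a + \<beta>))) * (ennreal overlap_bound * d)"
    unfolding ennreal_suminf_multc using bounded_overlap[OF elim] by (intro mult_left_mono mult_right_mono) auto
  also have "\<dots> = ennreal (C_avg (-(a + \<beta>)) * overlap_bound) * d"
    using C_avg_pos overlap_bound_pos by (simp add: ennreal_mult' less_imp_le mult.assoc)
  finally show ?case unfolding whitney_avg_eq by (intro enn_rpow_mono) auto
qed

end

section \<open>The pairing estimate\<close>

lemma enn_rpow_2: "enn_rpow x 2 = x\<^sup>2"
  by (cases x) (auto simp: enn_rpow_ennreal ennreal_power)

lemma Z_fin_mono:
  assumes "0 < q" and le: "\<And>z. norm (f z) \<le> norm (g z)"
  shows "Z_fin q a c f \<le> Z_fin q a c g"
proof -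
  have "whitney_avg c (kappa (-a) f) z \<le> whitney_avg c (kappa (-a) g) z" for z
    unfolding whitney_avg_def kappa_def using le
    by (intro enn_rpow_mono divide_right_mono_ennreal nn_integral_mono mult_right_mono ennreal_leI power_mono)
      (auto intro!: mult_left_mono)
  then show ?thesis
    unfolding Z_fin_def using assms(1) by (intro enn_rpow_mono nn_integral_mono) auto
qed

lemma suminf_tail_tendsto_0:
  fixes x :: "nat \<Rightarrow> ennreal"
  assumes "(\<Sum>i. x i) < \<infinity>"
  shows "(\<lambda>k. \<Sum>i. if i < k then 0 else x i) \<longlonglongrightarrow> 0"
proof -
  have fin: "x i < top" for i using ennreal_suminf_lessD[OF assms, of i] by simp
  define y where "y i = enn2real (x i)" for i
  have x: "x i = ennreal (y i)" "0 \<le> y i" for i using fin by (auto simp: y_def)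
  have sy: "summable y"
    using assms x by (intro summable_suminf_not_top) auto
  have eq: "(\<Sum>i. if i < k then 0 else x i) = ennreal (suminf y - sum y {..<k})" for k
  proof -
    let ?y = "\<lambda>i. if i < k then 0 else y i"
    have s1: "summable ?y"
      using sy x(2) by (intro summable_comparison_test'[OF sy, of 0]) auto
    have s2: "summable (\<lambda>i. if i < k then y i else 0)"
      by (rule summable_finite[of "{..<k}"]) auto
    have "suminf y = (\<Sum>i. ?y i + (if i < k then y i else 0))" by (intro suminf_cong) auto
    also have "\<dots> = suminf ?y + (\<Sum>i. if i < k then y i else 0)"
      by (rule suminf_add[OF s1 s2, symmetric])
    also have "(\<Sum>i. if i < k then y i else 0) = sum y {..<k}"
      by (subst suminf_finite[of "{..<k}"]) auto
    finally have "suminf ?y = suminf y - sum y {..<k}" by simp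
    moreover have "(\<Sum>i. if i < k then 0 else x i) = (\<Sum>i. ennreal (?y i))"
      by (intro suminf_cong) (auto simp: x)
    ultimately show ?thesis using s1 x(2) by (simp add: suminf_ennreal2)
  qed
  have "(\<lambda>k. suminf y - sum y {..<k}) \<longlonglongrightarrow> suminf y - suminf y"
    by (intro tendsto_intros summable_LIMSEQ sy)
  from tendsto_ennrealI[OF this] show ?thesis unfolding eq by simp
qed

context whitney_cover
begin

lemma rpow_dens:
  "enn_rpow (dens a i f) (1/2) = ennreal (T i powr (a - (N + 1) / 2)) * enn_rpow (mass i f) (1/2)"
  unfolding dens_def by (simp add: enn_rpow_mult enn_rpow_ennreal powr_powr diff_divide_distrib)

lemma rpow_discrete_term:
  assumes "0 < p"
  shows "enn_rpow (ennreal (T i powr N) * enn_rpow (dens a i f) (p/2)) (1/p)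
    = ennreal (T i powr (N / p)) * enn_rpow (dens a i f) (1/2)"
  using assms by (simp add: enn_rpow_mult enn_rpow_ennreal enn_rpow_rpow powr_powr)

lemma cell_Cauchy_Schwarz:
  assumes [measurable]: "f \<in> borel_measurable lebesgue" "g \<in> borel_measurable lebesgue"
  shows "(\<integral>\<^sup>+z. ennreal (norm (f z) * norm (g z)) * indicator (cell i) z \<partial>lebesgue)
    \<le> enn_rpow (mass i f) (1/2) * enn_rpow (mass i g) (1/2)"
proof -
  let ?F = "\<lambda>z. ennreal (norm (f z)) * indicator (cell i) z"
  let ?G = "\<lambda>z. ennreal (norm (g z)) * indicator (cell i) z"
  have sq: "(\<integral>\<^sup>+z. (ennreal (norm (h z)) * indicator (cell i) z)\<^sup>2 \<partial>lebesgue) = mass i h"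
    for h :: "_ \<Rightarrow> complex^'c"
    unfolding mass_def by (intro nn_integral_cong) (auto simp: indicator_def ennreal_power)
  have "(\<integral>\<^sup>+z. ennreal (norm (f z) * norm (g z)) * indicator (cell i) z \<partial>lebesgue) = (\<integral>\<^sup>+z. ?F z * ?G z \<partial>lebesgue)"
    by (intro nn_integral_cong) (auto simp: indicator_def ennreal_mult)
  moreover have "(\<integral>\<^sup>+z. ?F z * ?G z \<partial>lebesgue)\<^sup>2 \<le> mass i f * mass i g"
    unfolding sq[symmetric] by (intro Cauchy_Schwarz_nn_integral) measurable
  ultimately have "enn_rpow (\<integral>\<^sup>+z. ennreal (norm (f z) * norm (g z)) * indicator (cell i) z \<partial>lebesgue) 2 \<le> mass i f * mass i g"
    by (simp add: enn_rpow_2)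
  then show ?thesis by (subst (asm) enn_rpow_le_iff) (auto simp: enn_rpow_mult)
qed

definition C_pair :: "real \<Rightarrow> real \<Rightarrow> real" where
  "C_pair p s = (C_avg (-s) powr (p/2) * (3 / (2 * v))) powr (1/p) * sqrt (C_avg (-(-s + N * (1/p - 1))))"

lemma C_pair_pos: "C_pair p s > 0"
  unfolding C_pair_def using C_avg_pos v_pos by (intro mult_pos_pos) (auto simp: less_imp_neq[THEN not_sym])

lemma pairing_bound:
  fixes f g :: "real \<times> (real^'n) \<Rightarrow> complex^'m"
  assumes p: "0 < p" "p \<le> 1"
    and [measurable]: "f \<in> borel_measurable lebesgue" "g \<in> borel_measurable lebesgue"
  shows "(\<integral>\<^sup>+z. ennreal (norm (cinner (f z) (g z))) \<partial>half_measure)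
    \<le> ennreal (C_pair p s) * Z_fin p s c f * Z_inf (-s) (N * (1/p - 1)) c g"
proof -
  let ?\<beta> = "N * (1/p - 1)"
  let ?a = "-(-s + ?\<beta>)"
  let ?A = "C_avg (-s) powr (p/2) * (3 / (2 * v))"
  let ?h = "\<lambda>z. ennreal (norm (f z) * norm (g z))"
  let ?x = "\<lambda>i. ennreal (T i powr N) * enn_rpow (dens (-s) i f) (p/2)"
  let ?S = "ennreal (sqrt (C_avg ?a)) * Z_inf (-s) ?\<beta> c g"
  have "(\<integral>\<^sup>+z. ennreal (norm (cinner (f z) (g z))) \<partial>half_measure) =
    (\<integral>\<^sup>+z. (indicator upper_half z * ennreal (1 / fst z)) * ennreal (norm (cinner (f z) (g z))) \<partial>lebesgue)"
    by (rule nn_integral_half_measure) measurable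
  \<comment> \<open>On each cell the density \<open>1 / fst z\<close> is replaced by its upper bound
    \<open>1 / T i\<close>, so that only Lebesgue masses remain.\<close>
  also have "\<dots> \<le> (\<integral>\<^sup>+z. (\<Sum>i. ennreal (1 / T i) * (?h z * indicator (cell i) z)) \<partial>lebesgue)"
  proof (rule nn_integral_mono)
    fix z
    show "(indicator upper_half z * ennreal (1 / fst z)) * ennreal (norm (cinner (f z) (g z))) \<le>
      (\<Sum>i. ennreal (1 / T i) * (?h z * indicator (cell i) z))"
    proof (cases "fst z > 0")
      case True
      then have z: "z \<in> cell (ix z)" by (rule cell_ix)
      note zb = cell_bounds[OF z]
      have "(indicator upper_half z * ennreal (1 / fst z)) * ennreal (norm (cinner (f z) (g z))) \<le> ennreal (1 / T (ix z)) * ?h z"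
        using True zb T_pos[of "ix z"] norm_cinner_le[of "f z" "g z"]
        by (intro mult_mono) (auto simp: upper_half_def intro!: ennreal_leI divide_left_mono)
      also have "\<dots> = (\<Sum>i. ennreal (1 / T i) * ?h z * indicator (cell i) z)"
        by (rule suminf_cmult_indicator[OF disjoint_cell z, symmetric])
      finally show ?thesis by (simp add: mult.assoc)
    qed (simp add: upper_half_def)
  qed
  also have "\<dots> = (\<Sum>i. \<integral>\<^sup>+z. ennreal (1 / T i) * (?h z * indicator (cell i) z) \<partial>lebesgue)"
    by (intro nn_integral_suminf) measurable
  also have "\<dots> = (\<Sum>i. ennreal (1 / T i) * (\<integral>\<^sup>+z. ?h z * indicator (cell i) z \<partial>lebesgue))"
    by (intro suminf_cong nn_integral_cmult) measurable
  also have "\<dots> \<le> (\<Sum>i. enn_rpow (?x i) (1/p) * ?S)"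
  proof (intro suminf_le summableI)
    fix i
    \<comment> \<open>The identity that determines the weight of the dual space: the \<ell>^p weight
      and the normalisations of the two densities multiply to \<open>1 / T i\<close> exactly for
      this choice of \<open>?\<beta>\<close>.\<close>
    have exps: "N / p + (- s - (N + 1) / 2) + (?a - (N + 1) / 2) = -1"
      using p by (simp add: field_simps)
    have "ennreal (1 / T i) = ennreal (T i powr (N / p)) * ennreal (T i powr (- s - (N + 1) / 2)) * ennreal (T i powr (?a - (N + 1) / 2))"
    proof -
      have "1 / T i = T i powr (N / p + (- s - (N + 1) / 2) + (?a - (N + 1) / 2))"
        unfolding exps using T_pos[of i] by (simp add: powr_minus_divide)
      also have "\<dots> = T i powr (N / p) * T i powr (- s - (N + 1) / 2) * T i powr (?a - (N + 1) / 2)"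
        by (simp only: powr_add)
      finally show ?thesis by (simp only: ennreal_mult mult_nonneg_nonneg powr_ge_zero)
    qed
    then have "ennreal (1 / T i) * (enn_rpow (mass i f) (1/2) * enn_rpow (mass i g) (1/2)) =
      ennreal (T i powr (N / p)) * enn_rpow (dens (-s) i f) (1/2) * enn_rpow (dens ?a i g) (1/2)"
      unfolding rpow_dens by (simp only: mult_ac)
    also have "\<dots> = enn_rpow (?x i) (1/p) * enn_rpow (dens ?a i g) (1/2)"
      using p by (simp add: rpow_discrete_term)
    also have "\<dots> \<le> enn_rpow (?x i) (1/p) * ?S"
    proof (intro mult_left_mono)
      have "enn_rpow (dens ?a i g) (1/2) \<le> enn_rpow (ennreal (C_avg ?a) * enn_rpow (Z_inf (-s) ?\<beta> c g) 2) (1/2)"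
        by (intro enn_rpow_mono dens_le_Z_inf) auto
      also have "\<dots> = ?S"
        using C_avg_pos[of ?a] by (simp add: enn_rpow_mult enn_rpow_rpow enn_rpow_ennreal powr_half_sqrt)
      finally show "enn_rpow (dens ?a i g) (1/2) \<le> ?S" .
    qed auto
    finally have *: "ennreal (1 / T i) * (enn_rpow (mass i f) (1/2) * enn_rpow (mass i g) (1/2)) \<le> enn_rpow (?x i) (1/p) * ?S" .
    have "ennreal (1 / T i) * (\<integral>\<^sup>+z. ?h z * indicator (cell i) z \<partial>lebesgue) \<le> ennreal (1 / T i) * (enn_rpow (mass i f) (1/2) * enn_rpow (mass i g) (1/2))"
      by (intro mult_left_mono cell_Cauchy_Schwarz) auto
    then show "ennreal (1 / T i) * (\<integral>\<^sup>+z. ?h z * indicator (cell i) z \<partial>lebesgue) \<le> enn_rpow (?x i) (1/p) * ?S"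
      using * by (rule order_trans)
  qed
  also have "\<dots> = (\<Sum>i. enn_rpow (?x i) (1/p)) * ?S" by simp
  also have "\<dots> \<le> enn_rpow (discrete_sum p s f) (1/p) * ?S"
    unfolding discrete_sum_def using p by (intro mult_right_mono suminf_enn_rpow_le) auto
  also have "\<dots> \<le> enn_rpow (ennreal ?A * enn_rpow (Z_fin p s c f) p) (1/p) * ?S"
    using p by (intro mult_right_mono enn_rpow_mono discrete_sum_le_Z_fin) auto
  also have "\<dots> = ennreal (?A powr (1/p)) * Z_fin p s c f * ?S"
    using p v_pos by (simp add: enn_rpow_mult enn_rpow_rpow enn_rpow_ennreal)
  also have "\<dots> = ennreal (C_pair p s) * Z_fin p s c f * Z_inf (-s) ?\<beta> c g"
  proof -
    have "ennreal (C_pair p s) = ennreal (?A powr (1/p)) * ennreal (sqrt (C_avg ?a))"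
      unfolding C_pair_def using C_avg_pos[of ?a] by (intro ennreal_mult) auto
    then show ?thesis by (simp only: mult_ac)
  qed
  finally show ?thesis .
qed

section \<open>Functions supported in one cell\<close>

definition C_fin :: "real \<Rightarrow> real \<Rightarrow> real" where
  "C_fin p s = (C_avg (-s) powr (p/2) * C_nbhd) powr (1/p)"

lemma C_fin_pos: "C_fin p s > 0"
  unfolding C_fin_def using C_avg_pos C_nbhd_pos by (simp add: less_imp_neq[THEN not_sym])

definition restr :: "nat \<Rightarrow> (real \<times> (real^'n) \<Rightarrow> complex^'m) \<Rightarrow> real \<times> (real^'n) \<Rightarrow> complex^'m" where
  "restr i f z = indicator (cell i) z *\<^sub>R f z"

lemma measurable_restr [measurable]:
  "f \<in> borel_measurable lebesgue \<Longrightarrow> restr i f \<in> borel_measurable lebesgue"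
  unfolding restr_def[abs_def] by measurable

lemma norm_restr_le: "norm (restr i f z) \<le> norm (f z)"
  by (simp add: restr_def indicator_def)

lemma mass_restr: "mass j (restr i f) = (if i = j then mass i f else 0)"
proof -
  have "ennreal ((norm (restr i f w))\<^sup>2) * indicator (cell j) w =
    (if i = j then ennreal ((norm (f w))\<^sup>2) * indicator (cell i) w else 0)" for w
    by (auto simp: restr_def indicator_def cell_def)
  then show ?thesis by (simp add: mass_def)
qed

text \<open>Only one term of the discrete sum survives, so on a single cell the quasinorm is bounded
  by a multiple of an L^2 norm. This gives the continuity needed to apply the Riesz theorem cell by
  cell.\<close>

lemma Z_fin_restr_le:
  assumes p: "0 < p" "p \<le> 1" and f: "f \<in> borel_measurable lebesgue"
  shows "Z_fin p s c (restr i f) \<le>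
    ennreal (C_fin p s * T i powr (N / p - s - (N + 1) / 2)) * enn_rpow (mass i f) (1/2)"
proof -
  let ?A = "C_avg (-s) powr (p/2) * C_nbhd"
  have "discrete_sum p s (restr i f) = ennreal (T i powr N) * enn_rpow (dens (-s) i (restr i f)) (p/2)"
    unfolding discrete_sum_def by (subst suminf_finite[of "{i}"]) (auto simp: dens_def mass_restr)
  moreover have "enn_rpow (Z_fin p s c (restr i f)) p \<le> ennreal ?A * discrete_sum p s (restr i f)"
    using p f by (intro Z_fin_le_discrete_sum) auto
  ultimately have "Z_fin p s c (restr i f) \<le> enn_rpow (ennreal ?A * (ennreal (T i powr N) * enn_rpow (dens (-s) i (restr i f)) (p/2))) (1/p)"
    using p by (simp add: enn_rpow_le_iff)
  also have "\<dots> = enn_rpow (ennreal ?A) (1/p) * (ennreal (T i powr (N / p)) * enn_rpow (dens (-s) i (restr i f)) (1/2))"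
    using p by (subst enn_rpow_mult) (auto simp: rpow_discrete_term)
  also have "\<dots> = ennreal (C_fin p s) * (ennreal (T i powr (N / p)) * (ennreal (T i powr (- s - (N + 1) / 2)) * enn_rpow (mass i f) (1/2)))"
    unfolding C_fin_def rpow_dens using C_nbhd_pos by (simp add: enn_rpow_ennreal mass_restr)
  also have "\<dots> = ennreal (C_fin p s * T i powr (N / p - s - (N + 1) / 2)) * enn_rpow (mass i f) (1/2)"
  proof -
    have "T i powr (N / p - s - (N + 1) / 2) = T i powr (N / p) * T i powr (- s - (N + 1) / 2)"
      unfolding powr_add[symmetric] by (simp add: algebra_simps)
    moreover have "ennreal (C_fin p s * (T i powr (N / p) * T i powr (- s - (N + 1) / 2))) =
      ennreal (C_fin p s) * (ennreal (T i powr (N / p)) * ennreal (T i powr (- s - (N + 1) / 2)))"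
      using C_fin_pos[of p s] by (simp add: ennreal_mult')
    ultimately show ?thesis by (simp only: mult_ac)
  qed
  finally show ?thesis .
qed

end

section \<open>Restriction to cells and uniqueness\<close>

context whitney_cover
begin

text \<open>A density instead of a restricted space, so that all cells share the same measurable
  functions. It is based on \<open>half_measure\<close>, not on Lebesgue measure, so that pairing
  with a restricted function is a plain integral (\<open>pairing_restr\<close>).\<close>

definition cell_measure :: "nat \<Rightarrow> (real \<times> (real^'n)) measure" where
  "cell_measure i = density half_measure (\<lambda>z. ennreal (indicator (cell i) z))"

lemma sets_cell_measure [measurable_cong]: "sets (cell_measure i) = sets lebesgue"
  by (simp add: cell_measure_def sets_half_measure)

lemma measurable_cell_measure: "borel_measurable (cell_measure i) = borel_measurable lebesgue"
  by (intro measurable_cong_sets sets_cell_measure refl)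

lemma measurable_half_measure: "borel_measurable half_measure = borel_measurable (lebesgue :: (real \<times> (real^'n)) measure)"
  by (intro measurable_cong_sets sets_half_measure refl)

lemma nn_integral_cell_measure:
  assumes [measurable]: "h \<in> borel_measurable lebesgue"
  shows "(\<integral>\<^sup>+z. h z \<partial>cell_measure i) =
    (\<integral>\<^sup>+z. indicator upper_half z * ennreal (1 / fst z) * (ennreal (indicator (cell i) z) * h z) \<partial>lebesgue)"
proof -
  have "(\<integral>\<^sup>+z. h z \<partial>cell_measure i) = (\<integral>\<^sup>+z. ennreal (indicator (cell i) z) * h z \<partial>half_measure)"
    unfolding cell_measure_def using assms by (intro nn_integral_density) (auto simp: measurable_half_measure)
  also have "\<dots> = (\<integral>\<^sup>+z. indicator upper_half z * ennreal (1 / fst z) * (ennreal (indicator (cell i) z) * h z) \<partial>lebesgue)"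
    by (intro nn_integral_half_measure) measurable
  finally show ?thesis .
qed

lemma integral_cell_measure:
  fixes h :: "_ \<Rightarrow> 'b::{banach, second_countable_topology}"
  assumes [measurable]: "h \<in> borel_measurable lebesgue"
  shows "(\<integral>z. h z \<partial>cell_measure i) = (\<integral>z. indicator (cell i) z *\<^sub>R h z \<partial>half_measure)"
  unfolding cell_measure_def using assms by (intro integral_density) (auto simp: measurable_half_measure)

lemma AE_cell_measure: "(AE z in cell_measure i. P z) \<longleftrightarrow> (AE z in half_measure. z \<in> cell i \<longrightarrow> P z)"
  unfolding cell_measure_def by (subst AE_density) (auto simp: indicator_def)

text \<open>On a cell the density 1/t lies between \<open>2 / (3 * T i)\<close> and
  \<open>1 / T i\<close>. The upper bound gives this estimate, the lower one its converse
  \<open>mass_le_nn_integral_cell\<close>.\<close>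

lemma nn_integral_cell_le_mass:
  assumes [measurable]: "f \<in> borel_measurable lebesgue"
  shows "(\<integral>\<^sup>+z. ennreal ((norm (f z))\<^sup>2) \<partial>cell_measure i) \<le> ennreal (1 / T i) * mass i f"
proof -
  have "(\<integral>\<^sup>+z. ennreal ((norm (f z))\<^sup>2) \<partial>cell_measure i) =
    (\<integral>\<^sup>+z. indicator upper_half z * ennreal (1 / fst z) * (ennreal (indicator (cell i) z) * ennreal ((norm (f z))\<^sup>2)) \<partial>lebesgue)"
    by (intro nn_integral_cell_measure) measurable
  also have "\<dots> \<le> (\<integral>\<^sup>+z. ennreal (1 / T i) * (ennreal ((norm (f z))\<^sup>2) * indicator (cell i) z) \<partial>lebesgue)"
  proof (intro nn_integral_mono)
    fix z
    show "indicator upper_half z * ennreal (1 / fst z) * (ennreal (indicator (cell i) z) * ennreal ((norm (f z))\<^sup>2))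
      \<le> ennreal (1 / T i) * (ennreal ((norm (f z))\<^sup>2) * indicator (cell i) z)"
    proof (cases "z \<in> cell i")
      case True
      note zb = cell_bounds[OF True]
      have "1 / fst z \<le> 1 / T i" using zb T_pos[of i] by (intro divide_left_mono) auto
      then show ?thesis using True zb by (auto simp: upper_half_def intro!: mult_right_mono ennreal_leI)
    qed simp
  qed
  also have "\<dots> = ennreal (1 / T i) * mass i f"
    unfolding mass_def by (intro nn_integral_cmult) measurable
  finally show ?thesis .
qed

lemma mass_le_nn_integral_cell:
  assumes [measurable]: "f \<in> borel_measurable lebesgue"
  shows "mass i f \<le> ennreal (3/2 * T i) * (\<integral>\<^sup>+z. ennreal ((norm (f z))\<^sup>2) \<partial>cell_measure i)"
proof -
  let ?h = "\<lambda>z. indicator upper_half z * ennreal (1 / fst z) * (ennreal (indicator (cell i) z) * ennreal ((norm (f z))\<^sup>2))"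
  have "mass i f \<le> (\<integral>\<^sup>+z. ennreal (3/2 * T i) * ?h z \<partial>lebesgue)"
    unfolding mass_def
  proof (intro nn_integral_mono)
    fix z
    show "ennreal ((norm (f z))\<^sup>2) * indicator (cell i) z \<le> ennreal (3/2 * T i) * ?h z"
    proof (cases "z \<in> cell i")
      case True
      note zb = cell_bounds[OF True]
      have "1 \<le> 3/2 * T i * (1 / fst z)" using zb T_pos[of i] by (simp add: field_simps)
      then have "1 * (norm (f z))\<^sup>2 \<le> 3/2 * T i * (1 / fst z) * (norm (f z))\<^sup>2"
        by (intro mult_right_mono) auto
      then have "ennreal ((norm (f z))\<^sup>2) \<le> ennreal (3/2 * T i * (1 / fst z) * (norm (f z))\<^sup>2)"
        by (intro ennreal_leI) simp
      also have "\<dots> = ennreal (3/2 * T i) * (ennreal (1 / fst z) * ennreal ((norm (f z))\<^sup>2))"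
        using zb T_pos[of i] by (simp add: ennreal_mult' mult.assoc flip: ennreal_mult)
      finally show ?thesis using True zb by (simp add: upper_half_def)
    qed simp
  qed
  also have "\<dots> = ennreal (3/2 * T i) * (\<integral>\<^sup>+z. ?h z \<partial>lebesgue)"
    by (intro nn_integral_cmult) measurable
  also have "(\<integral>\<^sup>+z. ?h z \<partial>lebesgue) = (\<integral>\<^sup>+z. ennreal ((norm (f z))\<^sup>2) \<partial>cell_measure i)"
    by (intro nn_integral_cell_measure[symmetric]) measurable
  finally show ?thesis .
qed

lemma sq_integrable_cellI:
  assumes f [measurable]: "f \<in> borel_measurable lebesgue" and fin: "mass i f < \<infinity>"
  shows "sq_integrable (cell_measure i) f"
proof -
  have "(\<integral>\<^sup>+z. ennreal ((norm (f z))\<^sup>2) \<partial>cell_measure i) < \<infinity>"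
    using nn_integral_cell_le_mass[OF f, of i] fin by (auto intro: order_le_less_trans simp: ennreal_mult_less_top)
  then show ?thesis unfolding sq_integrable_def integrable_iff_bounded measurable_cell_measure by simp
qed

lemma mass_le_integral_cell:
  assumes "sq_integrable (cell_measure i) f"
  shows "mass i f \<le> ennreal (3/2 * T i * (\<integral>z. (norm (f z))\<^sup>2 \<partial>cell_measure i))"
proof -
  have f: "f \<in> borel_measurable lebesgue" using assms by (simp add: sq_integrable_def measurable_cell_measure)
  have "(\<integral>\<^sup>+z. ennreal ((norm (f z))\<^sup>2) \<partial>cell_measure i) = ennreal (\<integral>z. (norm (f z))\<^sup>2 \<partial>cell_measure i)"
    using assms by (intro nn_integral_eq_integral) (auto simp: sq_integrable_def)
  moreover have "ennreal (3/2 * T i * (\<integral>z. (norm (f z))\<^sup>2 \<partial>cell_measure i)) =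
      ennreal (3/2 * T i) * ennreal (\<integral>z. (norm (f z))\<^sup>2 \<partial>cell_measure i)"
    using T_pos[of i] by (intro ennreal_mult) auto
  ultimately show ?thesis using mass_le_nn_integral_cell[OF f, of i] by simp
qed

lemma dens_finite_iff: "dens a i f < \<infinity> \<longleftrightarrow> mass i f < \<infinity>"
  unfolding dens_def using T_pos[of i] by (auto simp: ennreal_mult_less_top)

lemma mass_finite_Z_inf:
  assumes "g \<in> borel_measurable lebesgue" "Z_inf a \<beta> c g < \<infinity>"
  shows "mass i g < \<infinity>"
proof -
  have "ennreal (C_avg (-(a + \<beta>))) * enn_rpow (Z_inf a \<beta> c g) 2 < \<infinity>"
    using assms(2) by (simp add: ennreal_mult_less_top)
  with dens_le_Z_inf[OF assms(1), of a \<beta> i] have "dens (-(a + \<beta>)) i g < \<infinity>" by (rule order_le_less_trans)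
  then show ?thesis by (simp only: dens_finite_iff)
qed

lemma discrete_sum_finite:
  assumes "0 < p" "f \<in> borel_measurable lebesgue" "Z_fin p s c f < \<infinity>"
  shows "discrete_sum p s f < \<infinity>"
  by (rule order_le_less_trans[OF discrete_sum_le_Z_fin[OF assms(1,2)]])
    (use assms(3) in \<open>simp add: ennreal_mult_less_top\<close>)

lemma mass_finite_Z_fin:
  assumes "0 < p" "f \<in> borel_measurable lebesgue" "Z_fin p s c f < \<infinity>"
  shows "mass i f < \<infinity>"
proof -
  have "ennreal (T i powr N) * enn_rpow (dens (-s) i f) (p/2) < \<infinity>"
    using discrete_sum_finite[OF assms] unfolding discrete_sum_def by (rule ennreal_suminf_lessD)
  then have "dens (-s) i f \<noteq> top" using T_pos[of i] by (auto simp: ennreal_mult_less_top)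
  then have "dens (-s) i f < \<infinity>" by (simp add: less_top)
  then show ?thesis by (simp only: dens_finite_iff)
qed

lemma pairing_restr:
  assumes [measurable]: "f \<in> borel_measurable lebesgue" "g \<in> borel_measurable lebesgue"
  shows "pairing (restr i f) g = (\<integral>z. cinner (f z) (g z) \<partial>cell_measure i)"
proof -
  have "cinner (restr i f z) (g z) = indicator (cell i) z *\<^sub>R cinner (f z) (g z)" for z
    by (auto simp: restr_def indicator_def cinner_def)
  then show ?thesis unfolding pairing_def by (subst integral_cell_measure) auto
qed

lemma Z_fin_restr_finite:
  assumes "0 < p" "p \<le> 1" "f \<in> borel_measurable lebesgue" "mass i f < \<infinity>"
  shows "Z_fin p s c (restr i f) < \<infinity>"
  by (rule order_le_less_trans[OF Z_fin_restr_le[OF assms(1-3)]])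
    (use assms(4) in \<open>simp add: ennreal_mult_less_top\<close>)

text \<open>The test function is the difference itself, cut off to one cell: its mass there is
  finite, so it is admissible, and the difference of the two pairings is its squared L^2 norm.
  Countably many cells then cover the half-space.\<close>

lemma pairing_determines:
  fixes g1 g2 :: "real \<times> (real^'n) \<Rightarrow> complex^'m"
  assumes p: "0 < p" "p \<le> 1"
    and m [measurable]: "g1 \<in> borel_measurable lebesgue" "g2 \<in> borel_measurable lebesgue"
    and fin: "Z_inf a \<beta> c g1 < \<infinity>" "Z_inf a \<beta> c g2 < \<infinity>"
    and eq: "\<And>f. f \<in> borel_measurable lebesgue \<Longrightarrow> Z_fin p s c f < \<infinity> \<Longrightarrow> pairing f g1 = pairing f g2"
  shows "AE z in half_measure. g1 z = g2 z"
proof -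
  have "AE z in half_measure. z \<in> cell i \<longrightarrow> g1 z = g2 z" for i
  proof -
    let ?h = "\<lambda>z. g1 z - g2 z"
    have sq: "sq_integrable (cell_measure i) g1" "sq_integrable (cell_measure i) g2"
      using fin m by (auto intro!: sq_integrable_cellI mass_finite_Z_inf)
    then have h: "sq_integrable (cell_measure i) ?h" by (rule sq_integrable_diff)
    have "mass i ?h < \<infinity>" using mass_le_integral_cell[OF h] by (rule order_le_less_trans) simp
    then have "pairing (restr i ?h) g1 = pairing (restr i ?h) g2"
      using p by (intro eq Z_fin_restr_finite measurable_restr) auto
    then have "(\<integral>z. cinner (?h z) (g1 z) \<partial>cell_measure i) = (\<integral>z. cinner (?h z) (g2 z) \<partial>cell_measure i)"
      by (simp add: pairing_restr)
    then have "(\<integral>z. cinner (?h z) (g1 z) - cinner (?h z) (g2 z) \<partial>cell_measure i) = 0"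
      using sq_integrable_cinner[OF h sq(1)] sq_integrable_cinner[OF h sq(2)] by simp
    then have "complex_of_real (\<integral>z. (norm (?h z))\<^sup>2 \<partial>cell_measure i) = 0"
      unfolding cinner_diff_right[symmetric] cinner_self by (simp only: integral_complex_of_real)
    then have "AE z in cell_measure i. (norm (?h z))\<^sup>2 = 0"
      using h by (subst (asm) of_real_eq_0_iff, subst (asm) integral_nonneg_eq_0_iff_AE) (auto simp: sq_integrable_def)
    then show ?thesis unfolding AE_cell_measure by eventually_elim simp
  qed
  then have "AE z in half_measure. \<forall>i. z \<in> cell i \<longrightarrow> g1 z = g2 z" by (subst AE_all_countable) blast
  with AE_half_measure_pos show ?thesis by eventually_elim (use cell_ix in blast)
qed

lemma pairing_linear:
  fixes f1 f2 g :: "real \<times> (real^'n) \<Rightarrow> complex^'m"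
  assumes "integrable half_measure (\<lambda>z. cinner (f1 z) (g z))" "integrable half_measure (\<lambda>z. cinner (f2 z) (g z))"
  shows "pairing (\<lambda>z. a *s f1 z + b *s f2 z) g = a * pairing f1 g + b * pairing f2 g"
  using assms by (simp add: pairing_def cinner_add_left cinner_scale_left)

lemma pairing_integrable:
  fixes f g :: "real \<times> (real^'n) \<Rightarrow> complex^'m"
  assumes p: "0 < p" "p \<le> 1"
    and [measurable]: "f \<in> borel_measurable lebesgue" "g \<in> borel_measurable lebesgue"
    and fin: "Z_fin p s c f < \<infinity>" "Z_inf (-s) (N * (1/p - 1)) c g < \<infinity>"
  shows "integrable half_measure (\<lambda>z. cinner (f z) (g z))"
proof -
  have "(\<integral>\<^sup>+z. ennreal (norm (cinner (f z) (g z))) \<partial>half_measure) < \<infinity>"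
    by (rule order_le_less_trans[OF pairing_bound[OF p, of f g s]])
      (use fin in \<open>auto simp: ennreal_mult_less_top\<close>)
  then show ?thesis unfolding integrable_iff_bounded measurable_half_measure by simp
qed

text \<open>Values outside the half-space are kept, so that \<open>tail 0 f\<close> is
  \<open>f\<close> itself. They lie in no cell and hence do not contribute to any mass.\<close>

definition tail :: "nat \<Rightarrow> (real \<times> (real^'n) \<Rightarrow> complex^'m) \<Rightarrow> real \<times> (real^'n) \<Rightarrow> complex^'m" where
  "tail k f z = (if fst z > 0 \<and> ix z < k then 0 else f z)"

lemma ix_lebesgue [measurable]: "ix \<in> measurable lebesgue (count_space UNIV)"
  using ix by (intro measurable_completion) simp

lemma measurable_tail:
  assumes [measurable]: "f \<in> borel_measurable lebesgue"
  shows "tail k f \<in> borel_measurable lebesgue"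
proof -
  have [measurable]: "{z. fst z > 0 \<and> ix z < k} \<in> sets lebesgue"
  proof -
    have "{z. fst z > 0 \<and> ix z < k} \<in> sets borel" by measurable
    then show ?thesis by simp
  qed
  have "tail k f = (\<lambda>z. if z \<in> {z. fst z > 0 \<and> ix z < k} then 0 else f z)"
    by (simp add: tail_def fun_eq_iff)
  also have "\<dots> \<in> borel_measurable lebesgue" by measurable
  finally show ?thesis .
qed

lemma norm_tail_le: "norm (tail k f z) \<le> norm (f z)"
  by (simp add: tail_def)

lemma mass_tail: "mass i (tail k f) = (if i < k then 0 else mass i f)"
proof -
  have "ennreal ((norm (tail k f w))\<^sup>2) * indicator (cell i) w =
    (if i < k then 0 else ennreal ((norm (f w))\<^sup>2) * indicator (cell i) w)" for w
    by (auto simp: tail_def indicator_def cell_def)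
  then show ?thesis by (simp add: mass_def)
qed

text \<open>Cutting off finitely many cells turns the discrete sum into the tail of a convergent
  series.\<close>

lemma Z_fin_tail_tendsto_0:
  assumes p: "0 < p" "p \<le> 1" and f: "f \<in> borel_measurable lebesgue" "Z_fin p s c f < \<infinity>"
  shows "(\<lambda>k. enn_rpow (Z_fin p s c (tail k f)) p) \<longlonglongrightarrow> 0"
proof -
  let ?A = "C_avg (-s) powr (p/2) * C_nbhd"
  have ds: "discrete_sum p s (tail k f) = (\<Sum>i. if i < k then 0 else ennreal (T i powr N) * enn_rpow (dens (-s) i f) (p/2))" for k
    unfolding discrete_sum_def by (intro suminf_cong) (auto simp: dens_def mass_tail)
  have "(\<lambda>k. discrete_sum p s (tail k f)) \<longlonglongrightarrow> 0"
    unfolding ds using discrete_sum_finite[OF p(1) f] by (intro suminf_tail_tendsto_0) (simp add: discrete_sum_def)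
  then have "(\<lambda>k. ennreal ?A * discrete_sum p s (tail k f)) \<longlonglongrightarrow> ennreal ?A * 0"
    by (intro ennreal_tendsto_cmult) auto
  then have lim: "(\<lambda>k. ennreal ?A * discrete_sum p s (tail k f)) \<longlonglongrightarrow> 0" by simp
  show ?thesis
    by (rule tendsto_sandwich[OF _ _ tendsto_const lim])
      (auto intro!: always_eventually Z_fin_le_discrete_sum p measurable_tail f)
qed

text \<open>Removing the cells one at a time never changes the value of the functional, while its
  bound on the tails tends to 0. Each step uses additivity for two summands only, so no infinite sum
  has to pass through the functional.\<close>

lemma functional_eq_0:
  fixes \<Phi> :: "(real \<times> (real^'n) \<Rightarrow> complex^'m) \<Rightarrow> complex"
  assumes p: "0 < p" "p \<le> 1"
    and add: "\<And>f1 f2. f1 \<in> borel_measurable lebesgue \<Longrightarrow> f2 \<in> borel_measurable lebesgue \<Longrightarrow>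
      Z_fin p s c f1 < \<infinity> \<Longrightarrow> Z_fin p s c f2 < \<infinity> \<Longrightarrow> \<Phi> (\<lambda>z. f1 z + f2 z) = \<Phi> f1 + \<Phi> f2"
    and bound: "\<And>f. f \<in> borel_measurable lebesgue \<Longrightarrow> Z_fin p s c f < \<infinity> \<Longrightarrow>
      ennreal (norm (\<Phi> f)) \<le> ennreal B * Z_fin p s c f"
    and cell0: "\<And>f i. f \<in> borel_measurable lebesgue \<Longrightarrow> Z_fin p s c f < \<infinity> \<Longrightarrow> \<Phi> (restr i f) = 0"
    and f [measurable]: "f \<in> borel_measurable lebesgue" and fin: "Z_fin p s c f < \<infinity>"
  shows "\<Phi> f = 0"
proof -
  have tail: "tail k f \<in> borel_measurable lebesgue" "Z_fin p s c (tail k f) < \<infinity>" for k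
    using measurable_tail[OF f] order_le_less_trans[OF Z_fin_mono fin] p(1) norm_tail_le by blast+
  have restr: "restr k f \<in> borel_measurable lebesgue" "Z_fin p s c (restr k f) < \<infinity>" for k
    using measurable_restr[OF f] order_le_less_trans[OF Z_fin_mono fin] p(1) norm_restr_le by blast+
  have "\<Phi> (tail k f) = \<Phi> f" for k
  proof (induction k)
    case 0
    show ?case by (simp add: tail_def[abs_def])
  next
    case (Suc k)
    have "tail k f = (\<lambda>z. tail (Suc k) f z + restr k f z)"
      by (auto simp: fun_eq_iff tail_def restr_def indicator_def cell_def)
    then have "\<Phi> (tail k f) = \<Phi> (tail (Suc k) f) + \<Phi> (restr k f)"
      using add[OF tail(1) restr(1) tail(2) restr(2)] by simp
    then show ?case using Suc cell0[OF f fin, of k] by simp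
  qed
  then have "ennreal (norm (\<Phi> f)) \<le> ennreal B * Z_fin p s c (tail k f)" for k
    using bound[OF tail] by metis
  then have "enn_rpow (ennreal (norm (\<Phi> f))) p \<le> enn_rpow (ennreal B * Z_fin p s c (tail k f)) p" for k
    using p by (intro enn_rpow_mono) auto
  then have le: "enn_rpow (ennreal (norm (\<Phi> f))) p \<le> enn_rpow (ennreal B) p * enn_rpow (Z_fin p s c (tail k f)) p" for k
    using p by (simp add: enn_rpow_mult)
  have "(\<lambda>k. enn_rpow (ennreal B) p * enn_rpow (Z_fin p s c (tail k f)) p) \<longlonglongrightarrow> enn_rpow (ennreal B) p * 0"
    by (intro ennreal_tendsto_cmult Z_fin_tail_tendsto_0 p f fin) simp
  then have "enn_rpow (ennreal (norm (\<Phi> f))) p \<le> enn_rpow (ennreal B) p * 0"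
    by (rule LIMSEQ_le_const) (use le in blast)
  then show ?thesis by (simp add: enn_rpow_ennreal)
qed

end

section \<open>Representation of functionals\<close>

context whitney_cover
begin

text \<open>The square root is the loss in \<open>Z_inf_le\<close>; the other factor, times
  \<open>K\<close>, bounds the square roots of the densities of the representative.\<close>

definition C_dual :: "real \<Rightarrow> real \<Rightarrow> real" where
  "C_dual p s = sqrt (C_avg (-(-s + N * (1/p - 1))) * overlap_bound) * (3/2 * C_fin p s)"

lemma C_dual_pos: "C_dual p s > 0"
  unfolding C_dual_def using C_avg_pos overlap_bound_pos C_fin_pos by (intro mult_pos_pos) auto

lemma dual_representation:
  fixes L :: "(real \<times> (real^'n) \<Rightarrow> complex^'m) \<Rightarrow> complex"
  assumes p: "0 < p" "p \<le> 1"
    and lin: "\<And>f1 f2 a b. f1 \<in> borel_measurable lebesgue \<Longrightarrow> f2 \<in> borel_measurable lebesgue \<Longrightarrow>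
      Z_fin p s c f1 < \<infinity> \<Longrightarrow> Z_fin p s c f2 < \<infinity> \<Longrightarrow>
      L (\<lambda>z. a *s f1 z + b *s f2 z) = a * L f1 + b * L f2"
    and bound: "\<And>f. f \<in> borel_measurable lebesgue \<Longrightarrow> Z_fin p s c f < \<infinity> \<Longrightarrow>
      ennreal (norm (L f)) \<le> ennreal K * Z_fin p s c f"
    and K: "0 \<le> K"
  obtains g where "g \<in> borel_measurable lebesgue"
    "Z_inf (-s) (N * (1/p - 1)) c g \<le> ennreal (C_dual p s * K)"
    "\<And>f. f \<in> borel_measurable lebesgue \<Longrightarrow> Z_fin p s c f < \<infinity> \<Longrightarrow> L f = pairing f g"
proof -
  let ?\<beta> = "N * (1/p - 1)"
  let ?a = "-(-s + ?\<beta>)"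
  \<comment> \<open>The exponent from \<open>Z_fin_restr_le\<close>; accordingly \<open>E i\<close>
    bounds \<open>L\<close> on the i-th cell relative to the square root of the Lebesgue
    mass.\<close>
  define e where "e = N / p - s - (N + 1) / 2"
  define E where "E i = K * (C_fin p s * T i powr e)" for i
  have E: "0 \<le> E i" for i unfolding E_def using K C_fin_pos[of p s] by simp
  have mfin: "mass i f < \<infinity>" if "sq_integrable (cell_measure i) f" for i and f :: "real \<times> (real^'n) \<Rightarrow> complex^'m"
    using mass_le_integral_cell[OF that] by (rule order_le_less_trans) simp
  have meas: "f \<in> borel_measurable lebesgue" if "sq_integrable (cell_measure i) f" for i and f :: "real \<times> (real^'n) \<Rightarrow> complex^'m"
    using that by (simp add: sq_integrable_def measurable_cell_measure)
  have Zfin: "restr i f \<in> borel_measurable lebesgue" "Z_fin p s c (restr i f) < \<infinity>"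
    if "sq_integrable (cell_measure i) f" for i and f :: "real \<times> (real^'n) \<Rightarrow> complex^'m"
    using measurable_restr[OF meas[OF that]] Z_fin_restr_finite[OF p meas[OF that] mfin[OF that]] by blast+
  have Lbound: "norm (L (restr i f)) \<le> E i * sqrt (enn2real (mass i f))"
    if f: "sq_integrable (cell_measure i) f" for i f
  proof -
    have "ennreal (norm (L (restr i f))) \<le> ennreal K * Z_fin p s c (restr i f)"
      by (rule bound[OF Zfin[OF f]])
    also have "\<dots> \<le> ennreal K * (ennreal (C_fin p s * T i powr e) * enn_rpow (mass i f) (1/2))"
      unfolding e_def by (intro mult_left_mono Z_fin_restr_le p meas[OF f]) auto
    also have "\<dots> = ennreal (E i * sqrt (enn2real (mass i f)))"
    proof -
      have "mass i f = ennreal (enn2real (mass i f))" using mfin[OF f] by simp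
      then have "enn_rpow (mass i f) (1/2) = ennreal (sqrt (enn2real (mass i f)))"
        by (metis enn_rpow_ennreal enn2real_nonneg powr_half_sqrt)
      then show ?thesis unfolding E_def using K C_fin_pos[of p s]
        by (simp add: ennreal_mult' mult.assoc)
    qed
    finally show ?thesis using E[of i] by (simp add: ennreal_le_iff)
  qed
  have mass_le: "enn2real (mass i f) \<le> 3/2 * T i * (\<integral>z. (norm (f z))\<^sup>2 \<partial>cell_measure i)"
    if f: "sq_integrable (cell_measure i) f" for i and f :: "real \<times> (real^'n) \<Rightarrow> complex^'m"
    using enn2real_mono[OF mass_le_integral_cell[OF f]] T_pos[of i] by simp
  have "\<exists>g. sq_integrable (cell_measure i) g \<and>
      (\<forall>f. sq_integrable (cell_measure i) f \<longrightarrow> L (restr i f) = (\<integral>z. cinner (f z) (g z) \<partial>cell_measure i))" for i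
  proof -
    obtain g where "sq_integrable (cell_measure i) g"
      "\<And>f. sq_integrable (cell_measure i) f \<Longrightarrow> L (restr i f) = (\<integral>z. cinner (f z) (g z) \<partial>cell_measure i)"
    \<comment> \<open>The factor \<open>sqrt (3/2 * T i)\<close> passes from the Lebesgue mass to
      the norm of \<open>cell_measure i\<close>.\<close>
    proof (rule L2_Riesz_complex[where M = "cell_measure i" and F = "\<lambda>f. L (restr i f)" and B = "E i * sqrt (3/2 * T i)"])
      fix f g :: "real \<times> (real^'n) \<Rightarrow> complex^'m" and a b :: complex
      assume fg: "sq_integrable (cell_measure i) f" "sq_integrable (cell_measure i) g"
      have "restr i (\<lambda>x. a *s f x + b *s g x) = (\<lambda>z. a *s restr i f z + b *s restr i g z)"
        by (auto simp: restr_def indicator_def fun_eq_iff)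
      then show "L (restr i (\<lambda>x. a *s f x + b *s g x)) = a * L (restr i f) + b * L (restr i g)"
        using lin[OF Zfin(1)[OF fg(1)] Zfin(1)[OF fg(2)] Zfin(2)[OF fg(1)] Zfin(2)[OF fg(2)]] by simp
    next
      fix f :: "real \<times> (real^'n) \<Rightarrow> complex^'m"
      assume f: "sq_integrable (cell_measure i) f"
      have "norm (L (restr i f)) \<le> E i * sqrt (enn2real (mass i f))" by (rule Lbound[OF f])
      also have "\<dots> \<le> E i * sqrt (3/2 * T i * (\<integral>z. (norm (f z))\<^sup>2 \<partial>cell_measure i))"
        using E mass_le[OF f] by (intro mult_left_mono real_sqrt_le_mono) auto
      finally show "norm (L (restr i f)) \<le> E i * sqrt (3/2 * T i) * sqrt (\<integral>z. (norm (f z))\<^sup>2 \<partial>cell_measure i)"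
        by (simp only: real_sqrt_mult mult.assoc)
    qed blast
    then show ?thesis by blast
  qed
  then obtain G where G: "\<And>i. sq_integrable (cell_measure i) (G i)"
    "\<And>i f. sq_integrable (cell_measure i) f \<Longrightarrow> L (restr i f) = (\<integral>z. cinner (f z) (G i z) \<partial>cell_measure i)"
    by metis
  \<comment> \<open>Off the half-space \<open>g\<close> takes whatever value its label selects;
    \<open>half_measure\<close> does not see those points. Measurability follows because only
    countably many pieces are glued.\<close>
  define g where "g z = G (ix z) z" for z
  have g [measurable]: "g \<in> borel_measurable lebesgue"
    unfolding g_def by (rule measurable_compose_countable[OF meas[OF G(1)] ix_lebesgue])
  have gG: "z \<in> cell i \<Longrightarrow> g z = G i z" for z i by (simp add: g_def cell_def)
  have mass_g: "mass i g = mass i (G i)" for i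
    unfolding mass_def by (intro nn_integral_cong) (auto simp: indicator_def gG)
  \<comment> \<open>\<open>L\<close> is tested on the representative of the cell. The result is its
    squared norm in \<open>cell_measure i\<close>, hence at least the mass divided by
    \<open>3/2 * T i\<close>, and \<open>Lbound\<close> allows at most \<open>E i\<close> times the
    root of the mass. Cancelling one root bounds the mass.\<close>
  have dens_g: "dens ?a i g \<le> ennreal ((3/2 * C_fin p s * K)\<^sup>2)" for i
  proof -
    let ?m = "enn2real (mass i (G i))"
    let ?I = "\<integral>z. (norm (G i z))\<^sup>2 \<partial>cell_measure i"
    have "L (restr i (G i)) = complex_of_real ?I"
      unfolding G(2)[OF G(1)] cinner_self by (rule integral_complex_of_real)
    then have "?I \<le> E i * sqrt ?m" using Lbound[OF G(1), of i] by simp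
    then have "3/2 * T i * ?I \<le> 3/2 * T i * (E i * sqrt ?m)"
      using T_pos[of i] by (intro mult_left_mono) auto
    then have *: "sqrt ?m * sqrt ?m \<le> (3/2 * T i * E i) * sqrt ?m"
      using mass_le[OF G(1), of i] by simp
    have "sqrt ?m \<le> 3/2 * T i * E i"
    proof (cases "?m = 0")
      case True
      then show ?thesis using E[of i] T_pos[of i] by simp
    next
      case False
      then have "0 < sqrt ?m" by (simp add: less_le)
      with * show ?thesis by (rule mult_right_le_imp_le)
    qed
    then have "(sqrt ?m)\<^sup>2 \<le> (3/2 * T i * E i)\<^sup>2" by (intro power_mono) auto
    then have "?m \<le> (3/2 * T i * E i)\<^sup>2" by simp
    also have "\<dots> = (3/2 * C_fin p s * K)\<^sup>2 * T i powr (2 * e + 2)"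
    proof -
      have "T i powr (2 * e + 2) = T i powr ((e + 1) + (e + 1))" by (rule arg_cong[of _ _ "(powr) (T i)"]) simp
      also have "\<dots> = (T i powr e * T i) * (T i powr e * T i)"
        unfolding powr_add using T_pos[of i] by simp
      finally show ?thesis by (simp add: E_def power2_eq_square mult_ac)
    qed
    finally have m: "?m \<le> (3/2 * C_fin p s * K)\<^sup>2 * T i powr (2 * e + 2)" .
    have "dens ?a i g = ennreal (T i powr (2 * ?a - (N + 1)) * ?m)"
      unfolding dens_def mass_g using mfin[OF G(1), of i] by (simp add: ennreal_mult')
    also have "\<dots> \<le> ennreal (T i powr (2 * ?a - (N + 1)) * ((3/2 * C_fin p s * K)\<^sup>2 * T i powr (2 * e + 2)))"
      using m by (intro ennreal_leI mult_left_mono) auto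
    also have "T i powr (2 * ?a - (N + 1)) * ((3/2 * C_fin p s * K)\<^sup>2 * T i powr (2 * e + 2)) =
      (3/2 * C_fin p s * K)\<^sup>2 * (T i powr (2 * ?a - (N + 1)) * T i powr (2 * e + 2))" by (simp only: mult_ac)
    also have "T i powr (2 * ?a - (N + 1)) * T i powr (2 * e + 2) = 1"
    proof -
      \<comment> \<open>The scaling balance of the pairing estimate again: all powers of
        \<open>T i\<close> cancel, so the density bound is uniform over the cells.\<close>
      have "2 * ?a - (N + 1) + (2 * e + 2) = 0" unfolding e_def using p by (simp add: field_simps)
      then show ?thesis unfolding powr_add[symmetric] using T_pos[of i] by simp
    qed
    finally show ?thesis by simp
  qed
  have Zg: "Z_inf (-s) ?\<beta> c g \<le> ennreal (C_dual p s * K)"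
  proof -
    have nn: "0 \<le> C_avg ?a * overlap_bound" "0 \<le> 3/2 * C_fin p s * K"
      using C_avg_pos[of ?a] overlap_bound_pos C_fin_pos[of p s] K by auto
    have "Z_inf (-s) ?\<beta> c g \<le> enn_rpow (ennreal (C_avg ?a * overlap_bound) * ennreal ((3/2 * C_fin p s * K)\<^sup>2)) (1/2)"
      by (rule Z_inf_le[OF g dens_g])
    also have "\<dots> = ennreal (sqrt (C_avg ?a * overlap_bound)) * ennreal (3/2 * C_fin p s * K)"
      using nn by (simp add: enn_rpow_mult enn_rpow_ennreal powr_half_sqrt)
    also have "\<dots> = ennreal (C_dual p s * K)"
      unfolding C_dual_def using nn by (subst ennreal_mult[symmetric]) (auto simp: mult_ac)
    finally show ?thesis .
  qed
  then have Zg_fin: "Z_inf (-s) ?\<beta> c g < \<infinity>" by (rule order_le_less_trans) simp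
  have "L f - pairing f g = 0" if f: "f \<in> borel_measurable lebesgue" "Z_fin p s c f < \<infinity>" for f
  \<comment> \<open>By the choice of \<open>g\<close> the functional and the pairing agree on
    restrictions to single cells, and both are bounded; \<open>B\<close> adds up their
    bounds.\<close>
  proof (rule functional_eq_0[where \<Phi> = "\<lambda>f. L f - pairing f g" and p = p and s = s
        and B = "K + C_pair p s * (C_dual p s * K)"])
    fix f1 f2 :: "real \<times> (real^'n) \<Rightarrow> complex^'m"
    assume f12: "f1 \<in> borel_measurable lebesgue" "f2 \<in> borel_measurable lebesgue"
      "Z_fin p s c f1 < \<infinity>" "Z_fin p s c f2 < \<infinity>"
    have "pairing (\<lambda>z. 1 *s f1 z + 1 *s f2 z) g = 1 * pairing f1 g + 1 * pairing f2 g"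
      using f12 p g Zg_fin by (intro pairing_linear pairing_integrable[where p = p and s = s]) auto
    then show "L (\<lambda>z. f1 z + f2 z) - pairing (\<lambda>z. f1 z + f2 z) g = L f1 - pairing f1 g + (L f2 - pairing f2 g)"
      using lin[OF f12, of 1 1] by simp
  next
    fix f :: "real \<times> (real^'n) \<Rightarrow> complex^'m"
    assume f: "f \<in> borel_measurable lebesgue" "Z_fin p s c f < \<infinity>"
    have int: "integrable half_measure (\<lambda>z. cinner (f z) (g z))"
      using f p g Zg_fin by (intro pairing_integrable[where p = p and s = s])
    have "ennreal (norm (pairing f g)) \<le> (\<integral>\<^sup>+z. ennreal (norm (cinner (f z) (g z))) \<partial>half_measure)"
      unfolding pairing_def using int by (rule integral_norm_bound_ennreal)
    also have "\<dots> \<le> ennreal (C_pair p s) * Z_fin p s c f * Z_inf (-s) ?\<beta> c g"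
      by (rule pairing_bound[OF p f(1) g])
    also have "\<dots> \<le> ennreal (C_pair p s) * Z_fin p s c f * ennreal (C_dual p s * K)"
      using Zg by (intro mult_left_mono) auto
    finally have P: "ennreal (norm (pairing f g)) \<le> ennreal (C_pair p s) * Z_fin p s c f * ennreal (C_dual p s * K)" .
    have "ennreal (norm (L f - pairing f g)) \<le> ennreal (norm (L f)) + ennreal (norm (pairing f g))"
      by (simp add: norm_triangle_ineq4 ennreal_leI flip: ennreal_plus)
    also have "\<dots> \<le> ennreal K * Z_fin p s c f + ennreal (C_pair p s) * Z_fin p s c f * ennreal (C_dual p s * K)"
      by (intro add_mono bound f P)
    also have "\<dots> = ennreal (K + C_pair p s * (C_dual p s * K)) * Z_fin p s c f"
    proof -
      have "ennreal (K + C_pair p s * (C_dual p s * K)) = ennreal K + ennreal (C_pair p s) * ennreal (C_dual p s * K)"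
        using K C_pair_pos[of p s] C_dual_pos[of p s] by (simp add: ennreal_plus ennreal_mult)
      then show ?thesis by (simp only: distrib_left distrib_right mult_ac)
    qed
    finally show "ennreal (norm (L f - pairing f g)) \<le> ennreal (K + C_pair p s * (C_dual p s * K)) * Z_fin p s c f" .
    fix i
    have sq: "sq_integrable (cell_measure i) f"
      using f p by (intro sq_integrable_cellI mass_finite_Z_fin[where p = p and s = s])
    have "L (restr i f) = (\<integral>z. cinner (f z) (G i z) \<partial>cell_measure i)" by (rule G(2)[OF sq])
    also have "\<dots> = (\<integral>z. cinner (f z) (g z) \<partial>cell_measure i)"
    proof (rule integral_cong_AE)
      show "AE z in cell_measure i. cinner (f z) (G i z) = cinner (f z) (g z)"
        unfolding AE_cell_measure by (auto simp: gG)
    qed (use f(1) g meas[OF G(1)] in \<open>auto simp: measurable_cell_measure\<close>)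
    also have "\<dots> = pairing (restr i f) g" using f(1) g by (simp add: pairing_restr)
    finally show "L (restr i f) - pairing (restr i f) g = 0" by simp
  qed (use p f in auto)
  then show ?thesis using that[OF g Zg] by simp
qed

end

text \<open>Taken together, the clauses make the pairing, conjugate-linear in its second argument, a
  bijection of the dual exponent space modulo null functions onto the bounded functionals, bounded
  in both directions.\<close>

theorem theorem2p28:
  fixes p s :: real and c :: "real \<times> real"
  assumes "0 < p" "p \<le> 1" "whitney_param c"
  defines "Zp \<equiv> (\<lambda>f :: real \<times> (real^'n) \<Rightarrow> complex^'m. Z_fin p s c f)"
      and "Zp' \<equiv> (\<lambda>g :: real \<times> (real^'n) \<Rightarrow> complex^'m. Z_inf (-s) (real CARD('n) * (1/p - 1)) c g)"
  shows "\<exists>C>0.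
    (\<forall>f g. f \<in> borel_measurable lebesgue \<longrightarrow> g \<in> borel_measurable lebesgue \<longrightarrow>
       (\<integral>\<^sup>+ z. ennreal (norm (cinner (f z) (g z))) \<partial>half_measure) \<le> ennreal C * Zp f * Zp' g)
    \<and>
    (\<forall>L :: (real \<times> (real^'n) \<Rightarrow> complex^'m) \<Rightarrow> complex. \<forall>K::real.
       (\<forall>f1 f2 a b. f1 \<in> borel_measurable lebesgue \<longrightarrow> f2 \<in> borel_measurable lebesgue \<longrightarrow>
          Zp f1 < \<infinity> \<longrightarrow> Zp f2 < \<infinity> \<longrightarrow>
          L (\<lambda>z. a *s f1 z + b *s f2 z) = a * L f1 + b * L f2)
       \<longrightarrow> (\<forall>f. f \<in> borel_measurable lebesgue \<longrightarrow> Zp f < \<infinity> \<longrightarrow>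
              ennreal (norm (L f)) \<le> ennreal K * Zp f)
       \<longrightarrow> (\<exists>g. g \<in> borel_measurable lebesgue \<and> Zp' g \<le> ennreal C * ennreal K \<and>
              (\<forall>f. f \<in> borel_measurable lebesgue \<longrightarrow> Zp f < \<infinity> \<longrightarrow> L f = pairing f g)))
    \<and>
    (\<forall>g1 g2. g1 \<in> borel_measurable lebesgue \<longrightarrow> g2 \<in> borel_measurable lebesgue \<longrightarrow>
       Zp' g1 < \<infinity> \<longrightarrow> Zp' g2 < \<infinity> \<longrightarrow>
       (\<forall>f. f \<in> borel_measurable lebesgue \<longrightarrow> Zp f < \<infinity> \<longrightarrow> pairing f g1 = pairing f g2) \<longrightarrow>
       (AE z in half_measure. g1 z = g2 z))"
proof -
  obtain ix :: "real \<times> (real^'n) \<Rightarrow> nat" and T v where "whitney_cover c ix T v CARD('n)"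
    using whitney_cover_exists[OF assms(3)] by blast
  then interpret whitney_cover c ix T v "CARD('n)" .
  note p = assms(1,2)
  define C where "C = max (C_pair p s) (C_dual p s)"
  have C: "C_pair p s \<le> C" "C_dual p s \<le> C" "0 < C"
    using C_pair_pos[of p s] by (auto simp: C_def less_max_iff_disj)
  show ?thesis unfolding Zp_def Zp'_def
  proof (intro exI[of _ C] conjI allI impI C)
    fix f g :: "real \<times> (real^'n) \<Rightarrow> complex^'m"
    assume fg: "f \<in> borel_measurable lebesgue" "g \<in> borel_measurable lebesgue"
    show "(\<integral>\<^sup>+ z. ennreal (norm (cinner (f z) (g z))) \<partial>half_measure)
      \<le> ennreal C * Z_fin p s c f * Z_inf (- s) (real CARD('n) * (1 / p - 1)) c g"
      using C by (intro order_trans[OF pairing_bound[OF p fg, of s]] mult_right_mono ennreal_leI) auto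
  next
    fix L :: "(real \<times> (real^'n) \<Rightarrow> complex^'m) \<Rightarrow> complex" and K :: real
    assume lin: "\<forall>f1 f2 a b. f1 \<in> borel_measurable lebesgue \<longrightarrow> f2 \<in> borel_measurable lebesgue \<longrightarrow>
        Z_fin p s c f1 < \<infinity> \<longrightarrow> Z_fin p s c f2 < \<infinity> \<longrightarrow>
        L (\<lambda>z. a *s f1 z + b *s f2 z) = a * L f1 + b * L f2"
      and bound: "\<forall>f. f \<in> borel_measurable lebesgue \<longrightarrow> Z_fin p s c f < \<infinity> \<longrightarrow>
        ennreal (norm (L f)) \<le> ennreal K * Z_fin p s c f"
    \<comment> \<open>A negative \<open>K\<close> is read as 0 by \<open>ennreal\<close>, whereas
      the representation is proved for a nonnegative real bound.\<close>
    have K: "ennreal K = ennreal (max K 0)" by (simp add: max_def ennreal_neg)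
    obtain g where g: "g \<in> borel_measurable lebesgue"
      "Z_inf (-s) (real CARD('n) * (1/p - 1)) c g \<le> ennreal (C_dual p s * max K 0)"
      "\<And>f. f \<in> borel_measurable lebesgue \<Longrightarrow> Z_fin p s c f < \<infinity> \<Longrightarrow> L f = pairing f g"
      by (rule dual_representation[OF p, where L = L and K = "max K 0"])
        (use lin bound in \<open>auto simp flip: K\<close>)
    have "ennreal (C_dual p s * max K 0) \<le> ennreal (C * max K 0)"
      using C by (intro ennreal_leI mult_right_mono) auto
    also have "\<dots> = ennreal C * ennreal K"
      unfolding K using C by (intro ennreal_mult) auto
    finally show "\<exists>g. g \<in> borel_measurable lebesgue \<and>
        Z_inf (- s) (real CARD('n) * (1 / p - 1)) c g \<le> ennreal C * ennreal K \<and>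
        (\<forall>f. f \<in> borel_measurable lebesgue \<longrightarrow> Z_fin p s c f < \<infinity> \<longrightarrow> L f = pairing f g)"
      using g order_trans by blast
  next
    fix g1 g2 :: "real \<times> (real^'n) \<Rightarrow> complex^'m"
    assume "g1 \<in> borel_measurable lebesgue" "g2 \<in> borel_measurable lebesgue"
      "Z_inf (- s) (real CARD('n) * (1 / p - 1)) c g1 < \<infinity>"
      "Z_inf (- s) (real CARD('n) * (1 / p - 1)) c g2 < \<infinity>"
      "\<forall>f. f \<in> borel_measurable lebesgue \<longrightarrow> Z_fin p s c f < \<infinity> \<longrightarrow> pairing f g1 = pairing f g2"
    then show "AE z in half_measure. g1 z = g2 z"
      by (intro pairing_determines[OF p]) auto
  qed
qed

end
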